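(* Let $\mathbf{u}:I\to\mathbf{B}^{\mathrm{curl}}_k$ be a differentiable function of time on an interval $I$ that solves the semi-discrete discontinuous Galerkin scheme: for all $t\in I$ and all $\mathbf{v}\in\mathbf{B}^{\mathrm{curl}}_k$, $$\sum_{C\in\mathcal{C}}\int_C\mathbf{v}\cdot\partial_t\mathbf{u}-\sum_{C\in\mathcal{C}}\int_C g\,\nabla^\perp\cdot\mathbf{v}+\sum_{S\in\mathcal{S}}\int_S[\mathbf{v}]_S\cdot\widetilde{\mathbf{G}}=0,$$ where $g$ is a scalar function on the cells (which may depend nonlinearly on the unknowns of the system) and $\widetilde{\mathbf{G}}$ is the vector-valued numerical flux on the sides. If $\widetilde{\mathbf{G}}$ is orthogonal to $\mathbf{n}_S$ on every side $S\in\mathcal{S}$, then $\nabla^{\star}\mathbf{u}$ is conserved by the scheme, i.e. $\partial_t(\nabla^\star\mathbf{u})=0$.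
   Context: Notation: $\nabla=(\partial_x,\partial_y)$, $\nabla^{\perp}=(-\partial_y,\partial_x)$, so $\nabla^\perp\cdot\mathbf{v}=-\partial_yv_x+\partial_xv_y$. Mesh. $\Omega=\mathbb{T}^2$ is the flat two-dimensional torus, partitioned by a conforming mesh into a finite set $\mathcal{C}$ of straight-sided cells, either all triangles or all quadrangles. $\mathcal{S}$ is the set of sides. Each side $S$ is oriented once for all with unit normal $\mathbf{n}_S$; its left cell $L$ is the neighbouring cell for which $\mathbf{n}_S$ is outgoing, its right cell $R$ the one for which $\mathbf{n}_S$ is ingoing. The jump of a cellwise continuous (scalar or vector) function $f$ is $[f]_S=f_L-f_R$. Spaces ($k\ge0$ an integer). $\mathbb{P}_m$: polynomials of total degree $\le m$; $\mathbb{Q}_{i,j}$: polynomials of degree $\le i$ in $x$ and $\le j$ in $y$; $\mathbb{Q}_m=\mathbb{Q}_{m,m}$; spaces with a negative index are $\{0\}$. $\mathbb{A}_{k+1}$ is the space of continuous functions on $\Omega$ whose restriction to each cell is in $\mathbb{P}_{k+1}$ (triangular meshes) or $\mathbb{Q}_{k+1}$ (quadrangular meshes). $\mathbf{B}^{\mathrm{curl}}_k$ is a space of vector fields that are polynomial in each cell, with no continuity imposed between cells; it is one of the following, given locally on each cell: (1) discontinuous Nédélec: on triangles $\mathbb{P}_k^2+(-y,x)\mathbb{P}_k$; on quadrangles $\mathbb{Q}_{k,k+1}\times\mathbb{Q}_{k+1,k}$; (2) on triangles: $\mathbb{P}_k^2$; (3) on quadrangles: $\big((\mathbb{Q}_{k,k}+\mathbb{Q}_{k-1,k+1})\times(\mathbb{Q}_{k,k}+\mathbb{Q}_{k+1,k-1})\big)\oplus\mathrm{Span}\,(x^ky^{k+1},\;x^{k+1}y^k)$.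 In all cases $\nabla$ maps $\mathbb{A}_{k+1}$ into $\mathbf{B}^{\mathrm{curl}}_k$ (cellwise derivative). Adjoint gradient. $\mathbb{A}_{k+1}$ and $\mathbf{B}^{\mathrm{curl}}_k$ carry the $L^2(\Omega)$ scalar product, and $\nabla^\star:\mathbf{B}^{\mathrm{curl}}_k\to\mathbb{A}_{k+1}$ is defined by $\langle\nabla^\star\mathbf{u}|f\rangle_{\mathbb{A}_{k+1}}=\langle\mathbf{u}|\nabla f\rangle_{\mathbf{B}^{\mathrm{curl}}_k}$ for all $\mathbf{u}\in\mathbf{B}^{\mathrm{curl}}_k$, $f\in\mathbb{A}_{k+1}$ (so $-\nabla^\star$ is a discrete divergence). The scheme discretizes $\partial_t\mathbf{u}+\nabla^\perp g=0$. It is understood that at each time $g$ is integrable on each cell and $\widetilde{\mathbf{G}}$ (single-valued on each side) is integrable on each side. *)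

theory Defs
  imports "HOL-Analysis.Analysis" "HOL-Library.Function_Algebras" "HOL-Library.Set_Algebras"
begin

type_synonym point = "real \<times> real"

text \<open>The torus is \<open>\<real>\<^sup>2 / \<int>\<^sup>2\<close>. Functions on it are \<open>\<int>\<^sup>2\<close>-periodic functions on the plane, and
  cells and sides are given by representatives in the plane.\<close>

definition lattice :: "point set" where
  "lattice = \<int> \<times> \<int>"

definition periodic :: "(point \<Rightarrow> 'a) \<Rightarrow> bool" where
  "periodic f \<longleftrightarrow> (\<forall>x. \<forall>z\<in>lattice. f (x + z) = f x)"


section \<open>Polynomial spaces\<close>

definition poly_space :: "(nat \<times> nat) set \<Rightarrow> (point \<Rightarrow> real) set" where
  "poly_space M = {f. \<exists>c. f = (\<lambda>(x, y). \<Sum>(i, j)\<in>M. c i j * x ^ i * y ^ j)}"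

text \<open>Degrees are integers: the space is \<open>{0}\<close> when one of them is negative.\<close>

definition P_space :: "int \<Rightarrow> (point \<Rightarrow> real) set" where
  "P_space m = poly_space {(i, j). int i + int j \<le> m}"

definition Q_space :: "int \<Rightarrow> int \<Rightarrow> (point \<Rightarrow> real) set" where
  "Q_space a b = poly_space {(i, j). int i \<le> a \<and> int j \<le> b}"

definition field_space :: "(point \<Rightarrow> real) set \<Rightarrow> (point \<Rightarrow> real) set \<Rightarrow> (point \<Rightarrow> point) set" where
  "field_space V W = {\<lambda>x. (p x, q x) | p q. p \<in> V \<and> q \<in> W}"

datatype curl_space = Nedelec_triangle | Nedelec_quadrangle | Full_triangle | Reduced_quadrangle

fun corners :: "curl_space \<Rightarrow> nat" where
  "corners Nedelec_triangle = 3"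
| "corners Nedelec_quadrangle = 4"
| "corners Full_triangle = 3"
| "corners Reduced_quadrangle = 4"

text \<open>Below, \<open>+\<close> between sets of functions is the sum of subspaces. Although written in the plane
  coordinates of a representative, each of these spaces is invariant under translations, so that
  the choice of the representative of a cell is immaterial.\<close>

fun local_A :: "curl_space \<Rightarrow> nat \<Rightarrow> (point \<Rightarrow> real) set" where
  "local_A Nedelec_triangle k = P_space (int k + 1)"
| "local_A Full_triangle k = P_space (int k + 1)"
| "local_A Nedelec_quadrangle k = Q_space (int k + 1) (int k + 1)"
| "local_A Reduced_quadrangle k = Q_space (int k + 1) (int k + 1)"

fun local_B :: "curl_space \<Rightarrow> nat \<Rightarrow> (point \<Rightarrow> point) set" where
  "local_B Nedelec_triangle k =
     field_space (P_space (int k)) (P_space (int k))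
     + {\<lambda>(x, y). p (x, y) *\<^sub>R (- y, x) | p. p \<in> P_space (int k)}"
| "local_B Nedelec_quadrangle k =
     field_space (Q_space (int k) (int k + 1)) (Q_space (int k + 1) (int k))"
| "local_B Full_triangle k = field_space (P_space (int k)) (P_space (int k))"
| "local_B Reduced_quadrangle k =
     field_space (Q_space (int k) (int k) + Q_space (int k - 1) (int k + 1))
                 (Q_space (int k) (int k) + Q_space (int k + 1) (int k - 1))
     + {\<lambda>(x, y). c *\<^sub>R (x ^ k * y ^ (k + 1), x ^ (k + 1) * y ^ k) | c. True}"


section \<open>Differential operators\<close>

definition partial_x :: "(point \<Rightarrow> real) \<Rightarrow> point \<Rightarrow> real" where
  "partial_x f = (\<lambda>(x, y). deriv (\<lambda>s. f (s, y)) x)"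

definition partial_y :: "(point \<Rightarrow> real) \<Rightarrow> point \<Rightarrow> real" where
  "partial_y f = (\<lambda>(x, y). deriv (\<lambda>s. f (x, s)) y)"

definition grad :: "(point \<Rightarrow> real) \<Rightarrow> point \<Rightarrow> point" where
  "grad f = (\<lambda>x. (partial_x f x, partial_y f x))"

definition perp_div :: "(point \<Rightarrow> point) \<Rightarrow> point \<Rightarrow> real" where
  "perp_div v = (\<lambda>x. - partial_y (\<lambda>p. fst (v p)) x + partial_x (\<lambda>p. snd (v p)) x)"


section \<open>Polygons\<close>

type_synonym polygon = "point list"

fun polyline :: "point list \<Rightarrow> real \<Rightarrow> point" where
  "polyline [] = linepath 0 0"
| "polyline [a] = linepath a a"
| "polyline [a, b] = linepath a b"
| "polyline (a # b # c # ps) = linepath a b +++ polyline (b # c # ps)"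

definition boundary :: "polygon \<Rightarrow> point set" where
  "boundary vs = path_image (polyline (vs @ [hd vs]))"

definition region :: "polygon \<Rightarrow> point set" where
  "region vs = boundary vs \<union> inside (boundary vs)"

text \<open>The last condition excludes corners with a flat angle.\<close>

definition is_polygon :: "nat \<Rightarrow> polygon \<Rightarrow> bool" where
  "is_polygon n vs \<longleftrightarrow> n \<ge> 3 \<and> length vs = n \<and> simple_path (polyline (vs @ [hd vs])) \<and>
     (\<forall>i<n. \<not> collinear {vs ! i, vs ! ((i + 1) mod n), vs ! ((i + 2) mod n)})"

definition polygon_sides :: "polygon \<Rightarrow> point set set" where
  "polygon_sides vs =
     {closed_segment (vs ! i) (vs ! ((i + 1) mod length vs)) | i. i < length vs}"


section \<open>Meshes of the torus\<close>

text \<open>An oriented side is given by its end points \<open>(a, b)\<close>; reversing the order reverses the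
  unit normal.\<close>

type_synonym side = "point \<times> point"

definition segment :: "side \<Rightarrow> point set" where
  "segment S = closed_segment (fst S) (snd S)"

definition translate_side :: "point \<Rightarrow> side \<Rightarrow> side" where
  "translate_side z S = (fst S + z, snd S + z)"

definition side_normal :: "side \<Rightarrow> point" where
  "side_normal S = (case S of ((ax, ay), (bx, by)) \<Rightarrow>
     (1 / dist (ax, ay) (bx, by)) *\<^sub>R (by - ay, ax - bx))"

text \<open>A lifted cell \<open>(vs, z)\<close> is the translate by the period \<open>z\<close> of the representative \<open>vs\<close>. The
  two neighbours of a side are lifted cells, as a cell may touch the chosen representative of the
  side only after a translation.\<close>

type_synonym lifted_cell = "polygon \<times> point"

definition lift :: "lifted_cell \<Rightarrow> polygon" where
  "lift K = map (\<lambda>p. p + snd K) (fst K)"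

record mesh =
  cells :: "polygon set"
  sides :: "side set"
  left_cell :: "side \<Rightarrow> lifted_cell"
  right_cell :: "side \<Rightarrow> lifted_cell"

text \<open>Whether the vector \<open>n\<close>, normal to the side \<open>S\<close>, points out of or into the cell \<open>vs\<close>.\<close>

definition outgoing :: "polygon \<Rightarrow> side \<Rightarrow> point \<Rightarrow> bool" where
  "outgoing vs S n \<longleftrightarrow> (\<forall>x\<in>open_segment (fst S) (snd S). \<forall>\<^sub>F e in at_right 0.
     x - e *\<^sub>R n \<in> region vs \<and> x + e *\<^sub>R n \<notin> region vs)"

definition ingoing :: "polygon \<Rightarrow> side \<Rightarrow> point \<Rightarrow> bool" where
  "ingoing vs S n \<longleftrightarrow> outgoing vs S (- n)"

text \<open>Conformity: distinct (lifted) cells meet exactly in their common corners and sides.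
  Each side of the torus has exactly one oriented representative in \<open>sides M\<close>.\<close>

definition torus_mesh :: "nat \<Rightarrow> mesh \<Rightarrow> bool" where
  "torus_mesh n M \<longleftrightarrow>
     finite (cells M) \<and> (\<forall>vs\<in>cells M. is_polygon n vs) \<and>
     (\<Union>K\<in>cells M \<times> lattice. region (lift K)) = UNIV \<and>
     (\<forall>K\<in>cells M \<times> lattice. \<forall>K'\<in>cells M \<times> lattice. K \<noteq> K' \<longrightarrow>
        region (lift K) \<inter> region (lift K') =
          (set (lift K) \<inter> set (lift K')) \<union>
          \<Union>(polygon_sides (lift K) \<inter> polygon_sides (lift K'))) \<and>
     finite (sides M) \<and>
     (\<forall>vs\<in>cells M. \<forall>T\<in>polygon_sides vs.
        \<exists>!S. S \<in> sides M \<and> (\<exists>z\<in>lattice. segment (translate_side z S) = T)) \<and>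
     (\<forall>S\<in>sides M.
        left_cell M S \<in> cells M \<times> lattice \<and> segment S \<in> polygon_sides (lift (left_cell M S)) \<and>
        outgoing (lift (left_cell M S)) S (side_normal S) \<and>
        right_cell M S \<in> cells M \<times> lattice \<and> segment S \<in> polygon_sides (lift (right_cell M S)) \<and>
        ingoing (lift (right_cell M S)) S (side_normal S))"


section \<open>Cellwise functions and discrete spaces\<close>

text \<open>A cellwise function assigns to each representative cell a function in the plane coordinates of
  that representative; only its values on the closed cell matter.\<close>

definition side_trace :: "(polygon \<Rightarrow> point \<Rightarrow> 'a) \<Rightarrow> lifted_cell \<Rightarrow> point \<Rightarrow> 'a" where
  "side_trace f K x = f (fst K) (x - snd K)"

definition jump :: "mesh \<Rightarrow> (polygon \<Rightarrow> point \<Rightarrow> 'a::minus) \<Rightarrow> side \<Rightarrow> point \<Rightarrow> 'a" where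
  "jump M f S x = side_trace f (left_cell M S) x - side_trace f (right_cell M S) x"

definition cell_integral :: "polygon \<Rightarrow> (point \<Rightarrow> real) \<Rightarrow> real" where
  "cell_integral vs f = (LINT x:region vs|lborel. f x)"

text \<open>Integration along a side with respect to arc length.\<close>

definition side_integral :: "side \<Rightarrow> (point \<Rightarrow> real) \<Rightarrow> real" where
  "side_integral S f =
     dist (fst S) (snd S) * (LINT s:{0..1}|lborel. f (linepath (fst S) (snd S) s))"

definition side_integrable :: "side \<Rightarrow> (point \<Rightarrow> point) \<Rightarrow> bool" where
  "side_integrable S F \<longleftrightarrow> set_integrable lborel {0..1} (\<lambda>s. F (linepath (fst S) (snd S) s))"

definition A_space :: "curl_space \<Rightarrow> nat \<Rightarrow> mesh \<Rightarrow> (point \<Rightarrow> real) set" where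
  "A_space sp k M = {f. continuous_on UNIV f \<and> periodic f \<and>
     (\<forall>vs\<in>cells M. \<exists>p\<in>local_A sp k. \<forall>x\<in>region vs. f x = p x)}"

definition B_space :: "curl_space \<Rightarrow> nat \<Rightarrow> mesh \<Rightarrow> (polygon \<Rightarrow> point \<Rightarrow> point) set" where
  "B_space sp k M = (\<Pi>\<^sub>E vs\<in>cells M. local_B sp k)"

text \<open>The polynomial chosen below is unique, because a polygonal cell has interior points.\<close>

definition cell_poly :: "curl_space \<Rightarrow> nat \<Rightarrow> (point \<Rightarrow> real) \<Rightarrow> polygon \<Rightarrow> point \<Rightarrow> real" where
  "cell_poly sp k f vs = (SOME p. p \<in> local_A sp k \<and> (\<forall>x\<in>region vs. f x = p x))"

definition cell_grad ::
  "curl_space \<Rightarrow> nat \<Rightarrow> mesh \<Rightarrow> (point \<Rightarrow> real) \<Rightarrow> polygon \<Rightarrow> point \<Rightarrow> point" where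
  "cell_grad sp k M f = (\<lambda>vs\<in>cells M. grad (cell_poly sp k f vs))"

text \<open>The \<open>L\<^sup>2\<close> products; the unit square is a fundamental domain of the torus.\<close>

definition inner_A :: "(point \<Rightarrow> real) \<Rightarrow> (point \<Rightarrow> real) \<Rightarrow> real" where
  "inner_A f h = (LINT x:cbox (0, 0) (1, 1)|lborel. f x * h x)"

definition inner_B ::
  "mesh \<Rightarrow> (polygon \<Rightarrow> point \<Rightarrow> point) \<Rightarrow> (polygon \<Rightarrow> point \<Rightarrow> point) \<Rightarrow> real" where
  "inner_B M v w = (\<Sum>vs\<in>cells M. cell_integral vs (\<lambda>x. v vs x \<bullet> w vs x))"

definition adjoint_grad ::
  "curl_space \<Rightarrow> nat \<Rightarrow> mesh \<Rightarrow> (polygon \<Rightarrow> point \<Rightarrow> point) \<Rightarrow> point \<Rightarrow> real" where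
  "adjoint_grad sp k M u =
     (THE w. w \<in> A_space sp k M \<and>
        (\<forall>f\<in>A_space sp k M. inner_A w f = inner_B M u (cell_grad sp k M f)))"


section \<open>Time derivatives in the discrete spaces\<close>

text \<open>Derivatives at time \<open>t\<close>, within \<open>I\<close>, with respect to the \<open>L\<^sup>2\<close> norm.\<close>

definition has_time_derivative_A ::
  "(real \<Rightarrow> point \<Rightarrow> real) \<Rightarrow> (point \<Rightarrow> real) \<Rightarrow> real \<Rightarrow> real set \<Rightarrow> bool" where
  "has_time_derivative_A w d t I \<longleftrightarrow>
     ((\<lambda>s. let r = (\<lambda>x. (w s x - w t x) / (s - t) - d x) in sqrt (inner_A r r))
        \<longlongrightarrow> 0) (at t within I)"

definition has_time_derivative_B ::
  "mesh \<Rightarrow> (real \<Rightarrow> polygon \<Rightarrow> point \<Rightarrow> point) \<Rightarrow> (polygon \<Rightarrow> point \<Rightarrow> point)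
     \<Rightarrow> real \<Rightarrow> real set \<Rightarrow> bool" where
  "has_time_derivative_B M u d t I \<longleftrightarrow>
     ((\<lambda>s. let r = (\<lambda>vs x. (1 / (s - t)) *\<^sub>R (u s vs x - u t vs x) - d vs x)
           in sqrt (inner_B M r r)) \<longlongrightarrow> 0) (at t within I)"

end

theory Submission
  imports Defs
begin

text \<open>
The idea is to test the scheme with \<open>v = \<nabla>f\<close>, where \<open>f\<close> is any element of the continuous space
\<open>A\<close>. Three facts make every term but the first disappear. The cellwise gradient of \<open>f\<close> is an
admissible test function (\<open>cell_grad_in_B_space\<close>). Its rotated divergence is zero in each cell,
since second partial derivatives commute (\<open>perp_div_grad\<close>). On a side, the two traces of \<open>f\<close> are
the same function, so that their derivatives along the side agree and the jump of \<open>\<nabla>f\<close> is normal to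
the side (\<open>tangential_jump_cell_grad\<close>); a flux that is orthogonal to the normal is therefore
orthogonal to this jump (\<open>side_integral_cell_grad\<close>). What remains is
\<open>\<langle>\<partial>\<^sub>tu, \<nabla>f\<rangle> = 0\<close> for all \<open>f\<close>, that is, \<open>\<nabla>\<^sup>\<star>\<partial>\<^sub>tu = 0\<close>.

The rest is functional analysis in finite dimension. Because polynomials of bounded degree are
determined by their values on a finite grid, finitely many point values determine an element of \<open>A\<close>
(\<open>A_space_nodes\<close>), and this is all that is needed to build a finite orthonormal family \<open>E\<close> in which
every element of \<open>A\<close> is expanded (\<open>A_space_orthonormal_expansion\<close>). With \<open>E\<close> the adjoint gradient
exists and is unique (\<open>adjoint_grad\<close>). It also gives the exchange of \<open>\<nabla>\<^sup>\<star>\<close> with the time derivative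
(\<open>adjoint_grad_has_time_derivative_zero\<close>): the difference quotient \<open>D\<close> of \<open>\<nabla>\<^sup>\<star>u\<close> satisfies
\<open>\<parallel>D\<parallel>\<^sup>2 = \<Sum>e\<in>E. \<langle>D, e\<rangle>\<^sup>2\<close>, and \<open>\<langle>D, e\<rangle>\<close> is the product of \<open>\<nabla>e\<close> with the remainder of the
difference quotient of \<open>u\<close>, which tends to zero by the Cauchy-Schwarz inequality.

The geometry of the cells enters through two facts. A polygon has interior points, which follows from
the Jordan curve theorem (\<open>is_polygon_region\<close>), and so a function on it has at most one
polynomial representative. A side of a cell is a subset of the closed cell
(\<open>polygon_side_subset_region\<close>), and so the polynomials on both sides of it take the values of \<open>f\<close>
there.
\<close>

section \<open>Subspaces of function spaces\<close>

text \<open>One notion for scalar functions and for vector fields, stated with pointwise operations.\<close>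

definition fun_subspace :: "('a \<Rightarrow> 'b::real_vector) set \<Rightarrow> bool" where
  "fun_subspace V \<longleftrightarrow> (\<lambda>_. 0) \<in> V \<and> (\<forall>f\<in>V. \<forall>g\<in>V. (\<lambda>x. f x + g x) \<in> V) \<and>
     (\<forall>c. \<forall>f\<in>V. (\<lambda>x. c *\<^sub>R f x) \<in> V)"

lemma fun_subspaceI:
  assumes "(\<lambda>_. 0) \<in> V" "\<And>f g. f \<in> V \<Longrightarrow> g \<in> V \<Longrightarrow> (\<lambda>x. f x + g x) \<in> V"
    "\<And>c f. f \<in> V \<Longrightarrow> (\<lambda>x. c *\<^sub>R f x) \<in> V"
  shows "fun_subspace V"
  using assms by (auto simp: fun_subspace_def)

lemma fun_subspace_zero: "fun_subspace V \<Longrightarrow> (\<lambda>_. 0) \<in> V"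
  and fun_subspace_add: "fun_subspace V \<Longrightarrow> f \<in> V \<Longrightarrow> g \<in> V \<Longrightarrow> (\<lambda>x. f x + g x) \<in> V"
  and fun_subspace_scale: "fun_subspace V \<Longrightarrow> f \<in> V \<Longrightarrow> (\<lambda>x. c *\<^sub>R f x) \<in> V"
  by (auto simp: fun_subspace_def)

lemma fun_subspace_combine:
  assumes "fun_subspace V" "f \<in> V" "g \<in> V"
  shows "(\<lambda>x. a *\<^sub>R f x + b *\<^sub>R g x) \<in> V"
  by (intro fun_subspace_add fun_subspace_scale assms)

lemma fun_subspace_sum:
  assumes "fun_subspace V" "\<And>e. e \<in> E \<Longrightarrow> h e \<in> V"
  shows "(\<lambda>x. \<Sum>e\<in>E. h e x) \<in> V"
proof (cases "finite E")
  case True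
  from this assms(2) show ?thesis
    by (induction E) (simp_all add: fun_subspace_zero[OF assms(1)] fun_subspace_add[OF assms(1)])
next
  case False
  then show ?thesis by (simp add: fun_subspace_zero[OF assms(1)])
qed

lemma fun_subspace_set_plus:
  assumes "fun_subspace V" "fun_subspace W"
  shows "fun_subspace (V + W)"
proof (rule fun_subspaceI)
  have "(\<lambda>_. 0) + (\<lambda>_. 0) \<in> V + W"
    using assms by (intro set_plus_intro fun_subspace_zero)
  then show "(\<lambda>_. 0) \<in> V + W" by (simp add: plus_fun_def)
next
  fix f g assume "f \<in> V + W" "g \<in> V + W"
  then obtain p q p' q' where "p \<in> V" "q \<in> W" "f = p + q" "p' \<in> V" "q' \<in> W" "g = p' + q'"
    by (auto elim!: set_plus_elim)
  moreover have "(\<lambda>x. (p + q) x + (p' + q') x) = (\<lambda>x. p x + p' x) + (\<lambda>x. q x + q' x)"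
    by (auto simp: plus_fun_def)
  ultimately show "(\<lambda>x. f x + g x) \<in> V + W"
    by (simp add: set_plus_intro fun_subspace_add assms del: plus_fun_apply)
next
  fix c f assume "f \<in> V + W"
  then obtain p q where "p \<in> V" "q \<in> W" "f = p + q"
    by (auto elim!: set_plus_elim)
  moreover have "(\<lambda>x. c *\<^sub>R (p + q) x) = (\<lambda>x. c *\<^sub>R p x) + (\<lambda>x. c *\<^sub>R q x)"
    by (auto simp: plus_fun_def scaleR_right_distrib)
  ultimately show "(\<lambda>x. c *\<^sub>R f x) \<in> V + W"
    by (simp add: set_plus_intro fun_subspace_scale assms del: plus_fun_apply)
qed

section \<open>Finite-dimensional inner product spaces of functions\<close>

locale function_inner_product =
  fixes W :: "('a \<Rightarrow> real) set" and ip :: "('a \<Rightarrow> real) \<Rightarrow> ('a \<Rightarrow> real) \<Rightarrow> real"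
  assumes subspace: "fun_subspace W"
    and sym: "\<And>f h. ip f h = ip h f"
    and lin: "\<And>a b f g h. f \<in> W \<Longrightarrow> g \<in> W \<Longrightarrow> h \<in> W \<Longrightarrow>
      ip (\<lambda>x. a * f x + b * g x) h = a * ip f h + b * ip g h"
    and definite: "\<And>f. f \<in> W \<Longrightarrow> f \<noteq> (\<lambda>_. 0) \<Longrightarrow> ip f f > 0"
begin

lemma ip_zero: "h \<in> W \<Longrightarrow> ip (\<lambda>_. 0) h = 0"
  using lin[of h h h 0 0] by simp

lemma ip_scale: "f \<in> W \<Longrightarrow> h \<in> W \<Longrightarrow> ip (\<lambda>x. c * f x) h = c * ip f h"
  using lin[of f f h c 0] by simp

lemma ip_sum:
  assumes "finite E" "E \<subseteq> W" "h \<in> W"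
  shows "ip (\<lambda>x. \<Sum>e\<in>E. c e * e x) h = (\<Sum>e\<in>E. c e * ip e h)"
  using assms(1,2)
proof (induction E)
  case empty
  then show ?case by (simp add: ip_zero assms(3))
next
  case (insert e E)
  have "(\<lambda>x. \<Sum>e\<in>E. c e *\<^sub>R e x) \<in> W"
    using insert by (intro fun_subspace_sum[OF subspace] fun_subspace_scale[OF subspace]) auto
  then show ?case
    using insert lin[of e "\<lambda>x. \<Sum>e\<in>E. c e * e x" h "c e" 1] assms(3) by simp
qed

text \<open>Finite dimension is expressed by a finite set of points whose values determine the functions, and
the proof is a Gram-Schmidt process along these points. The functions that vanish at one point \<open>y\<close> form
a subspace of codimension at most one, with an orthonormal family \<open>E\<close> by induction. If the codimension
is one, the component \<open>r\<close> orthogonal to \<open>E\<close> of a function that is not in the subspace completes the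
family: subtracting the multiple of \<open>r\<close> with the same value at \<open>y\<close> leads back to the subspace.
The conclusion records the expansion only, since it contains Parseval's identity.\<close>

lemma orthonormal_expansion_exists:
  assumes "finite X" "fun_subspace V" "V \<subseteq> W"
    and "\<And>f. f \<in> V \<Longrightarrow> \<forall>x\<in>X. f x = 0 \<Longrightarrow> f = (\<lambda>_. 0)"
  shows "\<exists>E. finite E \<and> E \<subseteq> V \<and> (\<forall>f\<in>V. f = (\<lambda>x. \<Sum>e\<in>E. ip f e * e x))"
  using assms
proof (induction X arbitrary: V)
  case empty
  then have "f = (\<lambda>_. 0)" if "f \<in> V" for f using that by blast
  then show ?case by (intro exI[of _ "{}"]) auto
next
  case (insert y X)
  define V' where "V' = {f \<in> V. f y = 0}"
  have V': "fun_subspace V'"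
    using insert.prems(1) by (auto simp: V'_def fun_subspace_def)
  have "\<exists>E. finite E \<and> E \<subseteq> V' \<and> (\<forall>f\<in>V'. f = (\<lambda>x. \<Sum>e\<in>E. ip f e * e x))"
    using insert.prems by (intro insert.IH V') (auto simp: V'_def)
  then obtain E where E: "finite E" "E \<subseteq> V'"
    and exp: "\<And>f. f \<in> V' \<Longrightarrow> f = (\<lambda>x. \<Sum>e\<in>E. ip f e * e x)" by blast
  have EV: "E \<subseteq> V" and EW: "E \<subseteq> W" and V'W: "V' \<subseteq> W"
    using E insert.prems(2) by (auto simp: V'_def)
  show ?case
  proof (cases "V \<subseteq> V'")
    case True
    then show ?thesis using E EV exp by (intro exI[of _ E]) auto
  next
    case False
    then obtain e0 where e0: "e0 \<in> V" "e0 y \<noteq> 0" by (auto simp: V'_def)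
    define q where "q = (\<lambda>x. \<Sum>e\<in>E. ip e0 e * e x)"
    define r0 where "r0 = (\<lambda>x. 1 * e0 x + (-1) * q x)"
    have "(\<lambda>x. \<Sum>e\<in>E. ip e0 e *\<^sub>R e x) \<in> V'"
      using E by (intro fun_subspace_sum fun_subspace_scale V') auto
    then have q: "q \<in> V'" by (simp add: q_def)
    have r0V: "r0 \<in> V"
      using fun_subspace_combine[OF insert.prems(1), of e0 q 1 "-1"] e0 q
      by (simp add: r0_def V'_def)
    have r0y: "r0 y \<noteq> 0" using e0 q by (simp add: r0_def V'_def)
    have orth0: "ip r0 h = 0" if "h \<in> V'" for h
    proof -
      have h: "h \<in> W" using that V'W by auto
      \<comment> \<open>As \<open>h\<close> is equal to its expansion, its products with \<open>e0\<close> and with the projection \<open>q\<close>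
        are the same sum over \<open>E\<close>.\<close>
      have "ip q h = (\<Sum>e\<in>E. ip h e * ip e e0)"
        unfolding q_def using ip_sum[OF E(1) EW h, of "ip e0"] by (simp add: sym mult.commute)
      also have "\<dots> = ip (\<lambda>x. \<Sum>e\<in>E. ip h e * e x) e0"
        using ip_sum[OF E(1) EW, of e0 "ip h"] e0 insert.prems(2) by auto
      also have "\<dots> = ip e0 h" using exp[OF that] sym by simp
      finally show ?thesis
        unfolding r0_def using lin[of e0 q h 1 "-1"] e0 q V'W h insert.prems(2) by auto
    qed
    have pos: "ip r0 r0 > 0"
      using definite[of r0] r0V r0y insert.prems(2) by auto
    define c where "c = 1 / sqrt (ip r0 r0)"
    define r where "r = (\<lambda>x. c * r0 x)"
    have r0W: "r0 \<in> W" using r0V insert.prems(2) by auto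
    have rV: "r \<in> V"
      using fun_subspace_scale[OF insert.prems(1) r0V, of c] by (simp add: r_def)
    have rW: "r \<in> W" using rV insert.prems(2) by auto
    have ry: "r y \<noteq> 0" using r0y pos by (simp add: r_def c_def)
    have orth: "ip r h = 0" if "h \<in> V'" for h
      unfolding r_def using ip_scale[OF r0W, of h c] orth0[OF that] that V'W by auto
    have norm: "ip r r = 1"
    proof -
      have "ip r r = c * ip r0 r" 
        using ip_scale[OF r0W rW, of c] by (simp add: r_def)
      also have "ip r0 r = c * ip r0 r0"
        using ip_scale[OF r0W r0W, of c] by (simp add: r_def sym)
      finally show ?thesis using pos by (simp add: c_def)
    qed
    have "r \<notin> E" using ry E by (auto simp: V'_def)
    have "f = (\<lambda>x. \<Sum>e\<in>insert r E. ip f e * e x)" if f: "f \<in> V" for f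
    proof -
      define a where "a = f y / r y"
      define f' where "f' = (\<lambda>x. 1 * f x + (- a) * r x)"
      have f'V: "f' \<in> V'"
        using fun_subspace_combine[OF insert.prems(1) f rV, of 1 "-a"] ry
        by (simp add: f'_def V'_def a_def)
      have f': "f = (\<lambda>x. 1 * f' x + a * r x)" by (simp add: f'_def)
      have ipf: "ip f h = ip f' h + a * ip r h" if "h \<in> W" for h
        using lin[of f' r h 1 a] f'V V'W rW that by (subst f') auto
      have "ip f r = a" using ipf[OF rW] orth[OF f'V] norm sym[of f' r] by simp
      moreover have "ip f e = ip f' e" if "e \<in> E" for e
      proof -
        have "e \<in> V'" "e \<in> W" using that E EW by auto
        then show ?thesis using ipf orth by simp
      qed
      ultimately have "(\<lambda>x. \<Sum>e\<in>insert r E. ip f e * e x) =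
          (\<lambda>x. a * r x + (\<Sum>e\<in>E. ip f' e * e x))"
        using E(1) \<open>r \<notin> E\<close> by (intro ext) simp
      also have "\<dots> = (\<lambda>x. a * r x + f' x)" using exp[OF f'V] by metis
      also have "\<dots> = f" by (simp add: f'_def)
      finally show ?thesis by simp
    qed
    then show ?thesis using E EV rV by (intro exI[of _ "insert r E"]) auto
  qed
qed

text \<open>For a linear form \<open>L\<close>, the representative is \<open>\<Sum>e\<in>E. L e * e\<close>: pairing it with \<open>f\<close> gives \<open>L\<close>
applied to the expansion of \<open>f\<close>.\<close>

lemma riesz_representation:
  assumes E: "finite E" "E \<subseteq> W" and exp: "\<And>f. f \<in> W \<Longrightarrow> f = (\<lambda>x. \<Sum>e\<in>E. ip f e * e x)"
    and L: "\<And>a b f g. f \<in> W \<Longrightarrow> g \<in> W \<Longrightarrow> L (\<lambda>x. a * f x + b * g x) = a * L f + b * L g"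
  shows "\<exists>!w. w \<in> W \<and> (\<forall>f\<in>W. ip w f = L f)"
proof (rule ex_ex1I)
  have L0: "L (\<lambda>_. 0) = 0"
    using L[of "\<lambda>_. 0" "\<lambda>_. 0" 0 0] fun_subspace_zero[OF subspace] by simp
  have Lsum: "L (\<lambda>x. \<Sum>e\<in>F. c e * e x) = (\<Sum>e\<in>F. c e * L e)" if "finite F" "F \<subseteq> W" for F c
    using that
  proof (induction F)
    case (insert e F)
    have "(\<lambda>x. \<Sum>e\<in>F. c e *\<^sub>R e x) \<in> W"
      using insert by (intro fun_subspace_sum[OF subspace] fun_subspace_scale[OF subspace]) auto
    then show ?case
      using insert L[of e "\<lambda>x. \<Sum>e\<in>F. c e * e x" "c e" 1] by simp
  qed (simp add: L0)
  define w where "w = (\<lambda>x. \<Sum>e\<in>E. L e * e x)"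
  have "(\<lambda>x. \<Sum>e\<in>E. L e *\<^sub>R e x) \<in> W"
    using E by (intro fun_subspace_sum[OF subspace] fun_subspace_scale[OF subspace]) auto
  then have "w \<in> W" by (simp add: w_def)
  moreover have "ip w f = L f" if "f \<in> W" for f
  proof -
    have "ip w f = (\<Sum>e\<in>E. ip f e * L e)"
      unfolding w_def using ip_sum[OF E that, of L] by (simp add: sym mult.commute)
    also have "\<dots> = L (\<lambda>x. \<Sum>e\<in>E. ip f e * e x)" using Lsum[OF E, of "ip f"] by simp
    also have "\<dots> = L f" using exp[OF that] by simp
    finally show ?thesis .
  qed
  ultimately show "\<exists>w. w \<in> W \<and> (\<forall>f\<in>W. ip w f = L f)" by blast
next
  fix w w' assume "w \<in> W \<and> (\<forall>f\<in>W. ip w f = L f)" "w' \<in> W \<and> (\<forall>f\<in>W. ip w' f = L f)"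
  moreover from this have "ip w f = ip w' f" if "f \<in> W" for f using that by auto
  ultimately have "(\<lambda>x. \<Sum>e\<in>E. ip w e * e x) = (\<lambda>x. \<Sum>e\<in>E. ip w' e * e x)"
    using E(2) by (intro ext sum.cong) auto
  then show "w = w'" using exp[of w] exp[of w'] \<open>w \<in> W \<and> _\<close> \<open>w' \<in> W \<and> _\<close> by metis
qed

end

section \<open>Polynomials in two variables\<close>

lemma fun_subspace_poly_space: "fun_subspace (poly_space M)"
proof (rule fun_subspaceI)
  show "(\<lambda>_. 0) \<in> poly_space M"
    unfolding poly_space_def by (intro CollectI exI[of _ "\<lambda>_ _. 0"]) auto
next
  fix f g assume "f \<in> poly_space M" "g \<in> poly_space M"
  then obtain c d where c: "f = (\<lambda>(x, y). \<Sum>(i, j)\<in>M. c i j * x ^ i * y ^ j)"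
    and d: "g = (\<lambda>(x, y). \<Sum>(i, j)\<in>M. d i j * x ^ i * y ^ j)"
    unfolding poly_space_def by blast
  show "(\<lambda>x. f x + g x) \<in> poly_space M"
    unfolding poly_space_def c d
    by (intro CollectI exI[of _ "\<lambda>i j. c i j + d i j"])
      (auto simp: algebra_simps sum.distrib case_prod_beta)
next
  fix a f assume "f \<in> poly_space M"
  then obtain c where c: "f = (\<lambda>(x, y). \<Sum>(i, j)\<in>M. c i j * x ^ i * y ^ j)"
    unfolding poly_space_def by blast
  show "(\<lambda>x. a *\<^sub>R f x) \<in> poly_space M"
    unfolding poly_space_def c
    by (intro CollectI exI[of _ "\<lambda>i j. a * c i j"])
      (auto simp: algebra_simps sum_distrib_left case_prod_beta)
qed

definition monomial :: "nat \<Rightarrow> nat \<Rightarrow> point \<Rightarrow> real" where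
  "monomial i j = (\<lambda>(x, y). x ^ i * y ^ j)"

lemma monomial_in_poly_space:
  assumes "finite M" "(i, j) \<in> M"
  shows "(\<lambda>x. a * monomial i j x) \<in> poly_space M"
proof -
  have "(\<Sum>(i', j')\<in>M. (if (i', j') = (i, j) then a else 0) * x ^ i' * y ^ j') = a * (x ^ i * y ^ j)"
    for x y :: real
  proof -
    have "(\<Sum>(i', j')\<in>M. (if (i', j') = (i, j) then a else 0) * x ^ i' * y ^ j') =
      (\<Sum>m\<in>M. if m = (i, j) then a * (x ^ i * y ^ j) else 0)"
      by (intro sum.cong) (auto split: if_splits)
    then show ?thesis using assms by simp
  qed
  then show ?thesis
    unfolding poly_space_def monomial_def
    by (intro CollectI exI[of _ "\<lambda>i' j'. if (i', j') = (i, j) then a else 0"]) auto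
qed

lemma poly_space_expand:
  assumes "p \<in> poly_space M"
  obtains c where "p = (\<lambda>x. \<Sum>(i, j)\<in>M. c i j * monomial i j x)"
proof -
  obtain c where "p = (\<lambda>(x, y). \<Sum>(i, j)\<in>M. c i j * x ^ i * y ^ j)"
    using assms unfolding poly_space_def by blast
  then have "p = (\<lambda>x. \<Sum>(i, j)\<in>M. c i j * monomial i j x)"
    by (auto simp: fun_eq_iff monomial_def mult.assoc)
  then show ?thesis by (rule that)
qed

lemma poly_space_mono:
  assumes "M \<subseteq> N" "finite N"
  shows "poly_space M \<subseteq> poly_space N"
proof
  fix p assume "p \<in> poly_space M"
  then obtain c where p: "p = (\<lambda>x. \<Sum>(i, j)\<in>M. c i j * monomial i j x)"
    by (rule poly_space_expand)
  show "p \<in> poly_space N"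
    unfolding p using assms
    by (intro fun_subspace_sum fun_subspace_poly_space) (auto intro: monomial_in_poly_space)
qed

text \<open>The exponents that occur in the scalar space of each family, so that all four scalar spaces are
instances of one construction.\<close>

fun degrees :: "curl_space \<Rightarrow> nat \<Rightarrow> (nat \<times> nat) set" where
  "degrees Nedelec_triangle k = {(i, j). i + j \<le> k + 1}"
| "degrees Full_triangle k = {(i, j). i + j \<le> k + 1}"
| "degrees Nedelec_quadrangle k = {..k + 1} \<times> {..k + 1}"
| "degrees Reduced_quadrangle k = {..k + 1} \<times> {..k + 1}"

lemma degrees_subset: "degrees sp k \<subseteq> {..k + 1} \<times> {..k + 1}"
  by (cases sp) auto

lemma finite_degrees: "finite (degrees sp k)"
  by (rule finite_subset[OF degrees_subset]) auto

lemma local_A_eq: "local_A sp k = poly_space (degrees sp k)"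
  by (cases sp) (auto simp: P_space_def Q_space_def intro!: arg_cong[where f = poly_space])

lemma fun_subspace_local_A: "fun_subspace (local_A sp k)"
  by (simp add: local_A_eq fun_subspace_poly_space)

lemma finite_P_degrees: "finite {(i, j). int i + int j \<le> m}"
  by (rule finite_subset[of _ "{..nat m} \<times> {..nat m}"]) auto

lemma finite_Q_degrees: "finite {(i, j). int i \<le> a \<and> int j \<le> b}"
  by (rule finite_subset[of _ "{..nat a} \<times> {..nat b}"]) auto

text \<open>The polynomial is regarded as one in \<open>x\<close> whose coefficients are polynomials in \<open>y\<close>. For each node
\<open>y\<close> it has more than \<open>n\<close> roots, so its coefficients are zero at all nodes \<open>y\<close>; each of them thus
has more than \<open>n\<close> roots as well.\<close>

lemma vanishing_on_grid:
  assumes p: "p \<in> poly_space M" "M \<subseteq> {..n} \<times> {..n}"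
    and X: "finite X" "card X > n" and Y: "finite Y" "card Y > n"
    and zero: "\<And>x y. x \<in> X \<Longrightarrow> y \<in> Y \<Longrightarrow> p (x, y) = 0"
  shows "p = (\<lambda>_. 0)"
proof -
  have univariate: "d i = 0"
    if "i \<le> n" "finite Z" "card Z > n" "\<And>z. z \<in> Z \<Longrightarrow> (\<Sum>i\<le>n. d i * z ^ i) = 0"
    for d :: "nat \<Rightarrow> real" and i Z
  proof (rule ccontr)
    assume "d i \<noteq> 0"
    then have "finite {z. (\<Sum>i\<le>n. d i * z ^ i) = 0}" "card {z. (\<Sum>i\<le>n. d i * z ^ i) = 0} \<le> n"
      using Poly_Roots.polyfun_rootbound[of n d] that(1) by auto
    moreover have "card Z \<le> card {z. (\<Sum>i\<le>n. d i * z ^ i) = 0}"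
      using calculation(1) that(4) by (intro card_mono) auto
    ultimately show False using that(3) by simp
  qed
  have "p \<in> poly_space ({..n} \<times> {..n})"
    using p poly_space_mono[of M "{..n} \<times> {..n}"] by auto
  then obtain c where c: "p = (\<lambda>z. \<Sum>(i, j)\<in>{..n} \<times> {..n}. c i j * monomial i j z)"
    by (rule poly_space_expand)
  have pxy: "p (x, y) = (\<Sum>i\<le>n. (\<Sum>j\<le>n. c i j * y ^ j) * x ^ i)" for x y
  proof -
    have "p (x, y) = (\<Sum>i\<le>n. \<Sum>j\<le>n. c i j * monomial i j (x, y))"
      unfolding c by (simp add: sum.cartesian_product)
    then show ?thesis by (simp add: monomial_def sum_distrib_left sum_distrib_right mult_ac)
  qed
  have "(\<Sum>j\<le>n. c i j * y ^ j) = 0" if "i \<le> n" "y \<in> Y" for i y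
    using univariate[of i X "\<lambda>i. \<Sum>j\<le>n. c i j * y ^ j"] that X zero pxy by auto
  then have "c i j = 0" if "i \<le> n" "j \<le> n" for i j
    using univariate[of j Y "c i"] that Y by auto
  then show ?thesis unfolding c by (intro ext sum.neutral) auto
qed

text \<open>The interior contains a product of two open sets of reals, and these are infinite, so they contain
nodes enough for a grid.\<close>

lemma unisolvent_nodes:
  assumes "interior U \<noteq> {}"
  shows "\<exists>N. finite N \<and> N \<subseteq> U \<and>
    (\<forall>p\<in>local_A sp k. (\<forall>x\<in>N. p x = 0) \<longrightarrow> p = (\<lambda>_. 0))"
proof -
  obtain z where "z \<in> interior U" using assms by auto
  then obtain A B where AB: "open A" "open B" "z \<in> A \<times> B" "A \<times> B \<subseteq> interior U"
    by (metis open_prod_elim open_interior)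
  have "infinite A" "infinite B"
    using AB finite_imp_not_open by auto
  then obtain X Y where X: "X \<subseteq> A" "finite X" "card X = k + 2"
    and Y: "Y \<subseteq> B" "finite Y" "card Y = k + 2"
    by (metis infinite_arbitrarily_large)
  have "X \<times> Y \<subseteq> U" using X Y AB interior_subset[of U] by blast
  moreover have "p = (\<lambda>_. 0)" if "p \<in> local_A sp k" "\<forall>x\<in>X \<times> Y. p x = 0" for p
    using vanishing_on_grid[of p "degrees sp k" "k + 1" X Y] that X Y degrees_subset local_A_eq
    by auto
  ultimately show ?thesis using X Y by (intro exI[of _ "X \<times> Y"]) auto
qed

lemma local_A_cong:
  assumes "interior U \<noteq> {}" "p \<in> local_A sp k" "q \<in> local_A sp k" "\<And>x. x \<in> U \<Longrightarrow> p x = q x"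
  shows "p = q"
proof -
  obtain N where N: "N \<subseteq> U" "\<And>p. p \<in> local_A sp k \<Longrightarrow> (\<forall>x\<in>N. p x = 0) \<Longrightarrow> p = (\<lambda>_. 0)"
    using unisolvent_nodes[OF assms(1)] by metis
  have "(\<lambda>x. p x - q x) \<in> local_A sp k"
    using fun_subspace_combine[OF fun_subspace_local_A assms(2,3), of 1 "-1"] by simp
  then have "(\<lambda>x. p x - q x) = (\<lambda>_. 0)" by (rule N(2)) (use N(1) assms(4) in auto)
  then show ?thesis by (auto simp: fun_eq_iff)
qed

text \<open>The gradient is defined by partial derivatives; composing with the two coordinate lines recovers
it from the total derivative, for which the calculus of derivatives can be used.\<close>

lemma grad_eqI:
  assumes "(p has_derivative (\<lambda>h. v \<bullet> h)) (at x)"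
  shows "grad p x = v"
proof -
  obtain a b where x: "x = (a, b)" by force
  obtain v1 v2 where v: "v = (v1, v2)" by force
  have "((\<lambda>s. p (s, b)) has_derivative (\<lambda>h. v \<bullet> (h, 0))) (at a)"
    using assms unfolding x
    by (intro has_derivative_compose[of "\<lambda>s. (s, b)" "\<lambda>h. (h, 0)" a UNIV p, simplified])
      (auto intro!: derivative_eq_intros)
  then have "((\<lambda>s. p (s, b)) has_real_derivative v1) (at a)"
    by (simp add: has_field_derivative_def v mult_commute_abs)
  moreover
  have "((\<lambda>s. p (a, s)) has_derivative (\<lambda>h. v \<bullet> (0, h))) (at b)"
    using assms unfolding x
    by (intro has_derivative_compose[of "\<lambda>s. (a, s)" "\<lambda>h. (0, h)" b UNIV p, simplified])
      (auto intro!: derivative_eq_intros)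
  then have "((\<lambda>s. p (a, s)) has_real_derivative v2) (at b)"
    by (simp add: has_field_derivative_def v mult_commute_abs)
  ultimately show ?thesis
    by (simp add: grad_def partial_x_def partial_y_def x v DERIV_imp_deriv)
qed

lemma monomial_has_derivative:
  "(monomial i j has_derivative (\<lambda>h. (i * monomial (i - 1) j x, j * monomial i (j - 1) x) \<bullet> h)) (at x)"
proof -
  have "((\<lambda>x. fst x ^ i * snd x ^ j) has_derivative
     (\<lambda>h. (i * monomial (i - 1) j x, j * monomial i (j - 1) x) \<bullet> h)) (at x)"
    by (auto intro!: derivative_eq_intros simp: monomial_def case_prod_beta inner_prod_def algebra_simps)
  moreover have "monomial i j = (\<lambda>x. fst x ^ i * snd x ^ j)"
    by (auto simp: monomial_def fun_eq_iff)
  ultimately show ?thesis by simp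
qed

text \<open>The exponents are arbitrary functions of the summation index because the partial derivatives of a
polynomial are again sums of this kind; applying the formula twice gives the second derivatives.\<close>

lemma sum_monomials_has_derivative:
  assumes "finite I"
  shows "((\<lambda>x. \<Sum>m\<in>I. c m * monomial (a m) (b m) x) has_derivative
     (\<lambda>h. (\<Sum>m\<in>I. c m *\<^sub>R (real (a m) * monomial (a m - 1) (b m) x,
        real (b m) * monomial (a m) (b m - 1) x)) \<bullet> h)) (at x)"
  unfolding inner_sum_left inner_scaleR_left
  by (intro has_derivative_sum has_derivative_mult_right monomial_has_derivative)

lemmas grad_sum_monomials = grad_eqI[OF sum_monomials_has_derivative]

lemma has_derivative_local_A:
  assumes "p \<in> local_A sp k"
  shows "(p has_derivative (\<lambda>h. grad p x \<bullet> h)) (at x)"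
proof -
  obtain c where p: "p = (\<lambda>x. \<Sum>(i, j)\<in>degrees sp k. c i j * monomial i j x)"
    using assms unfolding local_A_eq by (rule poly_space_expand)
  show ?thesis
    using sum_monomials_has_derivative[OF finite_degrees, where c = "\<lambda>(i, j). c i j" and a = fst and b = snd]
      grad_sum_monomials[OF finite_degrees, where c = "\<lambda>(i, j). c i j" and a = fst and b = snd]
    unfolding p by (simp add: case_prod_beta)
qed

lemma grad_combine:
  assumes "p \<in> local_A sp k" "q \<in> local_A sp k"
  shows "grad (\<lambda>x. a * p x + b * q x) x = a *\<^sub>R grad p x + b *\<^sub>R grad q x"
  by (rule grad_eqI)
    (auto intro!: derivative_eq_intros has_derivative_local_A[OF assms(1)] has_derivative_local_A[OF assms(2)]
      simp: inner_add_left)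

text \<open>In either order, the second mixed derivative of \<open>monomial i j\<close> is \<open>i * j * monomial (i - 1) (j - 1)\<close>.\<close>

lemma perp_div_grad:
  assumes "p \<in> local_A sp k"
  shows "perp_div (grad p) x = 0"
proof -
  let ?D = "degrees sp k"
  obtain c where "p = (\<lambda>x. \<Sum>(i, j)\<in>?D. c i j * monomial i j x)"
    using assms unfolding local_A_eq by (rule poly_space_expand)
  then have p: "p = (\<lambda>x. \<Sum>m\<in>?D. c (fst m) (snd m) * monomial (fst m) (snd m) x)"
    by (simp add: case_prod_beta)
  define C where "C m = c (fst m) (snd m)" for m
  have g: "grad p y = (\<Sum>m\<in>?D. C m *\<^sub>R (real (fst m) * monomial (fst m - 1) (snd m) y,
        real (snd m) * monomial (fst m) (snd m - 1) y))" for y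
    unfolding p C_def by (rule grad_sum_monomials[OF finite_degrees])
  have g1: "fst (grad p y) = (\<Sum>m\<in>?D. (C m * real (fst m)) * monomial (fst m - 1) (snd m) y)"
    and g2: "snd (grad p y) = (\<Sum>m\<in>?D. (C m * real (snd m)) * monomial (fst m) (snd m - 1) y)" for y
    unfolding g by (simp_all add: fst_sum snd_sum mult.assoc)
  have "partial_y (\<lambda>y. fst (grad p y)) x = snd (grad (\<lambda>y. fst (grad p y)) x)"
    "partial_x (\<lambda>y. snd (grad p y)) x = fst (grad (\<lambda>y. snd (grad p y)) x)"
    by (simp_all add: grad_def)
  then show ?thesis
    unfolding perp_div_def g1 g2 grad_sum_monomials[OF finite_degrees]
    by (simp add: fst_sum snd_sum mult_ac)
qed

lemma fun_subspace_field_space: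
  assumes "fun_subspace V" "fun_subspace W"
  shows "fun_subspace (field_space V W)"
proof (rule fun_subspaceI)
  have "(\<lambda>x. (0, 0)) \<in> field_space V W"
    using assms[THEN fun_subspace_zero] unfolding field_space_def by fastforce
  then show "(\<lambda>_. 0) \<in> field_space V W" by (simp add: zero_prod_def)
next
  fix f g assume "f \<in> field_space V W" "g \<in> field_space V W"
  then obtain p q p' q' where "p \<in> V" "q \<in> W" "f = (\<lambda>x. (p x, q x))" "p' \<in> V" "q' \<in> W" "g = (\<lambda>x. (p' x, q' x))"
    by (auto simp: field_space_def)
  then show "(\<lambda>x. f x + g x) \<in> field_space V W"
    using assms unfolding field_space_def
    by (intro CollectI exI[of _ "\<lambda>x. p x + p' x"] exI[of _ "\<lambda>x. q x + q' x"]) (auto intro: fun_subspace_add)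
next
  fix c f assume "f \<in> field_space V W"
  then obtain p q where "p \<in> V" "q \<in> W" "f = (\<lambda>x. (p x, q x))"
    by (auto simp: field_space_def)
  then show "(\<lambda>x. c *\<^sub>R f x) \<in> field_space V W"
    using fun_subspace_scale[OF assms(1), of p c] fun_subspace_scale[OF assms(2), of q c]
    unfolding field_space_def
    by (intro CollectI exI[of _ "\<lambda>x. c * p x"] exI[of _ "\<lambda>x. c * q x"]) auto
qed

lemma fun_subspace_rotations:
  assumes "fun_subspace V"
  shows "fun_subspace {\<lambda>(x, y). p (x, y) *\<^sub>R (- y, x) | p. p \<in> V}"
proof (rule fun_subspaceI)
  show "(\<lambda>_. 0) \<in> {\<lambda>(x, y). p (x, y) *\<^sub>R (- y, x) | p. p \<in> V}"
    using fun_subspace_zero[OF assms]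
    by (intro CollectI exI[of _ "\<lambda>_. 0"]) (auto simp: fun_eq_iff zero_prod_def)
next
  fix f g assume "f \<in> {\<lambda>(x, y). p (x, y) *\<^sub>R (- y, x) | p. p \<in> V}" "g \<in> {\<lambda>(x, y). p (x, y) *\<^sub>R (- y, x) | p. p \<in> V}"
  then obtain p q where "p \<in> V" "q \<in> V" "f = (\<lambda>(x, y). p (x, y) *\<^sub>R (- y, x))" "g = (\<lambda>(x, y). q (x, y) *\<^sub>R (- y, x))"
    by auto
  then show "(\<lambda>x. f x + g x) \<in> {\<lambda>(x, y). p (x, y) *\<^sub>R (- y, x) | p. p \<in> V}"
    by (intro CollectI exI[of _ "\<lambda>x. p x + q x"]) (auto simp: fun_eq_iff algebra_simps intro!: fun_subspace_add assms)
next
  fix c f assume "f \<in> {\<lambda>(x, y). p (x, y) *\<^sub>R (- y, x) | p. p \<in> V}"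
  then obtain p where "p \<in> V" "f = (\<lambda>(x, y). p (x, y) *\<^sub>R (- y, x))"
    by auto
  then show "(\<lambda>x. c *\<^sub>R f x) \<in> {\<lambda>(x, y). p (x, y) *\<^sub>R (- y, x) | p. p \<in> V}"
    using fun_subspace_scale[OF assms, of p c]
    by (intro CollectI exI[of _ "\<lambda>x. c * p x"]) (auto simp: fun_eq_iff)
qed

lemma fun_subspace_line: "fun_subspace {\<lambda>(x, y). c *\<^sub>R F x y | c. True}"
proof (rule fun_subspaceI)
  show "(\<lambda>_. 0) \<in> {\<lambda>(x, y). c *\<^sub>R F x y | c. True}"
    by (intro CollectI exI[of _ 0]) (auto simp: fun_eq_iff)
next
  fix f g assume "f \<in> {\<lambda>(x, y). c *\<^sub>R F x y | c. True}" "g \<in> {\<lambda>(x, y). c *\<^sub>R F x y | c. True}"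
  then obtain a b where "f = (\<lambda>(x, y). a *\<^sub>R F x y)" "g = (\<lambda>(x, y). b *\<^sub>R F x y)" by auto
  then show "(\<lambda>x. f x + g x) \<in> {\<lambda>(x, y). c *\<^sub>R F x y | c. True}"
    by (intro CollectI exI[of _ "a + b"]) (auto simp: fun_eq_iff scaleR_left_distrib)
next
  fix d f assume "f \<in> {\<lambda>(x, y). c *\<^sub>R F x y | c. True}"
  then obtain a where "f = (\<lambda>(x, y). a *\<^sub>R F x y)" by auto
  then show "(\<lambda>x. d *\<^sub>R f x) \<in> {\<lambda>(x, y). c *\<^sub>R F x y | c. True}"
    by (intro CollectI exI[of _ "d * a"]) (auto simp: fun_eq_iff)
qed

lemma fun_subspace_local_B: "fun_subspace (local_B sp k)"
  by (cases sp; simp only: local_B.simps P_space_def Q_space_def;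
    intro fun_subspace_set_plus fun_subspace_field_space
      fun_subspace_poly_space fun_subspace_rotations fun_subspace_line)

lemma set_plus_left:
  assumes "f \<in> V" "fun_subspace W"
  shows "f \<in> V + W"
  using set_plus_intro[OF assms(1) fun_subspace_zero[OF assms(2)]] by (simp add: func_plus)

lemma set_plus_right:
  assumes "fun_subspace V" "f \<in> W"
  shows "f \<in> V + W"
  using set_plus_intro[OF fun_subspace_zero[OF assms(1)] assms(2)] by (simp add: func_plus)

lemma field_spaceI: "p \<in> V \<Longrightarrow> q \<in> W \<Longrightarrow> (\<lambda>x. (p x, q x)) \<in> field_space V W"
  by (auto simp: field_space_def)

text \<open>Only the reduced quadrangular space needs an argument, as the products of scalar
spaces in it are too small for some gradients. The monomials \<open>x\<^sup>i * y\<^sup>j\<close> with \<open>j = k + 1\<close> and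
\<open>i \<le> k\<close> have their \<open>x\<close>-derivative in
\<open>Q_space (k - 1) (k + 1)\<close>, and symmetrically in \<open>y\<close>. The one monomial left, \<open>x\<^sup>k\<^sup>+\<^sup>1 * y\<^sup>k\<^sup>+\<^sup>1\<close>, is the
reason for the additional line \<open>Span (x\<^sup>k * y\<^sup>k\<^sup>+\<^sup>1, x\<^sup>k\<^sup>+\<^sup>1 * y\<^sup>k)\<close>.\<close>

lemma grad_monomial_in_local_B:
  assumes "(i, j) \<in> degrees sp k"
  shows "(\<lambda>x. (real i * monomial (i - 1) j x, real j * monomial i (j - 1) x)) \<in> local_B sp k"
proof -
  have scaled: "(\<lambda>x. real l * monomial a b x) \<in> poly_space M" if "finite M" "l > 0 \<Longrightarrow> (a, b) \<in> M" for l a b M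
    using that by (cases "l = 0") (auto simp: fun_subspace_zero[OF fun_subspace_poly_space] intro: monomial_in_poly_space)
  note fs = fun_subspace_set_plus fun_subspace_field_space
      fun_subspace_poly_space fun_subspace_rotations fun_subspace_line
  note fin = finite_P_degrees finite_Q_degrees
  show ?thesis
  proof (cases sp)
    case Nedelec_triangle
    then show ?thesis using assms
      unfolding Nedelec_triangle local_B.simps P_space_def
      by (intro set_plus_left field_spaceI scaled fin fs) auto
  next
    case Full_triangle
    then show ?thesis using assms
      unfolding Full_triangle local_B.simps P_space_def
      by (intro field_spaceI scaled fin) auto
  next
    case Nedelec_quadrangle
    then show ?thesis using assms
      unfolding Nedelec_quadrangle local_B.simps Q_space_def
      by (intro field_spaceI scaled fin) auto
  next
    case Reduced_quadrangle
    show ?thesis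
    proof (cases "i = k + 1 \<and> j = k + 1")
      case True
      then have "(\<lambda>x. (real i * monomial (i - 1) j x, real j * monomial i (j - 1) x)) =
        (\<lambda>(x, y). real (k + 1) *\<^sub>R (x ^ k * y ^ (k + 1), x ^ (k + 1) * y ^ k))"
        by (auto simp: monomial_def fun_eq_iff)
      then show ?thesis
        unfolding Reduced_quadrangle local_B.simps Q_space_def
        by (intro set_plus_right fs) auto
    next
      case False
      have ij: "i \<le> k + 1" "j \<le> k + 1" using assms Reduced_quadrangle by auto
      have "(\<lambda>x. real i * monomial (i - 1) j x) \<in> Q_space (int k) (int k) + Q_space (int k - 1) (int k + 1)"
      proof (cases "j \<le> k")
        case True
        then show ?thesis using ij unfolding Q_space_def
          by (intro set_plus_left fs scaled fin) auto
      next
        case False2: False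
        then show ?thesis using ij False unfolding Q_space_def
          by (intro set_plus_right fs scaled fin) auto
      qed
      moreover
      have "(\<lambda>x. real j * monomial i (j - 1) x) \<in> Q_space (int k) (int k) + Q_space (int k + 1) (int k - 1)"
      proof (cases "i \<le> k")
        case True
        then show ?thesis using ij unfolding Q_space_def
          by (intro set_plus_left fs scaled fin) auto
      next
        case False2: False
        then show ?thesis using ij False unfolding Q_space_def
          by (intro set_plus_right fs scaled fin) auto
      qed
      ultimately show ?thesis
        unfolding Reduced_quadrangle local_B.simps
        by (intro set_plus_left[OF field_spaceI] fs)
    qed
  qed
qed

lemma grad_in_local_B:
  assumes "p \<in> local_A sp k"
  shows "grad p \<in> local_B sp k"
proof -
  let ?D = "degrees sp k"
  obtain c where "p = (\<lambda>x. \<Sum>(i, j)\<in>?D. c i j * monomial i j x)"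
    using assms unfolding local_A_eq by (rule poly_space_expand)
  then have p: "p = (\<lambda>x. \<Sum>m\<in>?D. c (fst m) (snd m) * monomial (fst m) (snd m) x)"
    by (simp add: case_prod_beta)
  have "grad p = (\<lambda>x. \<Sum>m\<in>?D. c (fst m) (snd m) *\<^sub>R (real (fst m) * monomial (fst m - 1) (snd m) x,
        real (snd m) * monomial (fst m) (snd m - 1) x))"
    unfolding p by (intro ext grad_sum_monomials[OF finite_degrees])
  also have "\<dots> \<in> local_B sp k"
    by (intro fun_subspace_sum fun_subspace_scale fun_subspace_local_B grad_monomial_in_local_B) auto
  finally show ?thesis .
qed

lemma continuous_poly_space:
  assumes "p \<in> poly_space M"
  shows "continuous_on A p"
  using assms unfolding poly_space_def case_prod_beta
  by (auto intro!: continuous_intros)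

lemma continuous_set_plus:
  fixes V W :: "('a::topological_space \<Rightarrow> 'b::real_normed_vector) set"
  assumes "f \<in> V + W" "\<And>g. g \<in> V \<Longrightarrow> continuous_on A g" "\<And>g. g \<in> W \<Longrightarrow> continuous_on A g"
  shows "continuous_on A f"
  using assms by (auto elim!: set_plus_elim intro!: continuous_intros simp: func_plus)

lemma continuous_field_space:
  assumes "f \<in> field_space V W" "\<And>g. g \<in> V \<Longrightarrow> continuous_on A g" "\<And>g. g \<in> W \<Longrightarrow> continuous_on A g"
  shows "continuous_on A f"
  using assms by (auto simp: field_space_def intro!: continuous_intros)

lemma continuous_local_B:
  assumes "v \<in> local_B sp k"
  shows "continuous_on A v"
proof (cases sp)
  case Nedelec_triangle
  then show ?thesis
    using assms unfolding local_B.simps P_space_def Nedelec_triangle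
    by (elim continuous_set_plus continuous_field_space)
     (auto simp: case_prod_beta intro!: continuous_intros intro: continuous_poly_space)
next
  case Full_triangle
  then show ?thesis
    using assms unfolding local_B.simps P_space_def Full_triangle
    by (elim continuous_field_space) (auto intro: continuous_poly_space)
next
  case Nedelec_quadrangle
  then show ?thesis
    using assms unfolding local_B.simps Q_space_def Nedelec_quadrangle
    by (elim continuous_field_space) (auto intro: continuous_poly_space)
next
  case Reduced_quadrangle
  then show ?thesis
    using assms unfolding local_B.simps Q_space_def Reduced_quadrangle
    by (elim continuous_set_plus continuous_field_space)
     (auto simp: case_prod_beta intro!: continuous_intros intro: continuous_poly_space elim!: continuous_set_plus)
qed

section \<open>Polygonal regions\<close>

text \<open>A point is inside when its component in the complement is bounded. A homeomorphism of the whole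
space maps components to components, and bounded sets to bounded sets because it maps their compact
closures to compact sets. This serves both for translations of cells and for the passage from the
complex plane to pairs of reals.\<close>

lemma inside_homeomorphic_image:
  fixes h :: "'a::euclidean_space \<Rightarrow> 'b::euclidean_space"
  assumes h: "homeomorphism UNIV UNIV h h'"
  shows "inside (h ` S) = h ` inside S"
proof -
  have sub: "h ` inside S \<subseteq> inside (h ` S)"
    if h: "homeomorphism UNIV UNIV h h'" for h :: "'c::euclidean_space \<Rightarrow> 'd::euclidean_space" and h' S
  proof
    fix y assume "y \<in> h ` inside S"
    then obtain x where x: "y = h x" "x \<notin> S" "bounded (connected_component_set (- S) x)"
      by (auto simp: inside_def)
    have hh: "\<And>x. h' (h x) = x" "\<And>y. h (h' y) = y" and cont: "continuous_on UNIV h" "continuous_on UNIV h'"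
      using h by (auto simp: homeomorphism_def)
    have "connected_component_set (- (h ` S)) y \<subseteq> h ` connected_component_set (- S) x"
    proof
      fix z assume "z \<in> connected_component_set (- (h ` S)) y"
      then obtain T where T: "connected T" "T \<subseteq> - (h ` S)" "y \<in> T" "z \<in> T"
        by (auto simp: connected_component_def)
      have "connected (h' ` T)"
        using T(1) cont(2) by (meson connected_continuous_image continuous_on_subset subset_UNIV)
      moreover have "h' ` T \<subseteq> - S"
      proof
        fix a assume "a \<in> h' ` T"
        then obtain t where "t \<in> T" "a = h' t" by blast
        then show "a \<in> - S" using T(2) hh(2)[of t] by (metis ComplD ComplI imageI subsetD)
      qed
      moreover have "x \<in> h' ` T" using T(3) x(1) hh(1)[of x] by (metis imageI)
      moreover have "h' z \<in> h' ` T" using T(4) by auto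
      ultimately have "h' z \<in> connected_component_set (- S) x"
        by (auto simp: connected_component_def)
      then show "z \<in> h ` connected_component_set (- S) x" using hh by (metis imageI)
    qed
    moreover have "bounded (h ` connected_component_set (- S) x)"
    proof -
      have "compact (h ` closure (connected_component_set (- S) x))"
        using x(3) cont(1) by (meson compact_closure compact_continuous_image continuous_on_subset subset_UNIV)
      then show ?thesis
        by (meson bounded_subset closure_subset compact_imp_bounded image_mono)
    qed
    ultimately have "bounded (connected_component_set (- (h ` S)) y)"
      by (meson bounded_subset)
    moreover have "y \<notin> h ` S" using x hh by (metis imageE)
    ultimately show "y \<in> inside (h ` S)" by (simp add: inside_def)
  qed
  have hh: "\<And>x. h' (h x) = x" "\<And>y. h (h' y) = y" using h by (auto simp: homeomorphism_def)
  show ?thesis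
  proof
    show "h ` inside S \<subseteq> inside (h ` S)" by (rule sub[OF h])
    have "h' ` inside (h ` S) \<subseteq> inside (h' ` h ` S)"
      by (rule sub[OF homeomorphism_symD[OF h]])
    also have "h' ` h ` S = S" by (simp add: image_image hh)
    finally show "inside (h ` S) \<subseteq> h ` inside S"
      using hh by (metis (no_types, lifting) image_subset_iff subsetI imageI)
  qed
qed

text \<open>The Jordan curve theorem for curves in the complex plane, transported to pairs of reals.\<close>

lemma Jordan_inside_nonempty:
  fixes c :: "real \<Rightarrow> real \<times> real"
  assumes "simple_path c" "pathfinish c = pathstart c"
  shows "inside (path_image c) \<noteq> {}"
proof -
  define h :: "real \<times> real \<Rightarrow> complex" where "h = (\<lambda>z. Complex (fst z) (snd z))"
  define h' :: "complex \<Rightarrow> real \<times> real" where "h' = (\<lambda>z. (Re z, Im z))"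
  have cont: "continuous_on UNIV h" "continuous_on UNIV h'"
    unfolding h_def h'_def by (auto intro!: continuous_intros simp: Complex_eq)
  have hom: "homeomorphism UNIV UNIV h h'"
    unfolding homeomorphism_def
  proof (intro conjI ballI cont)
    show "range h = UNIV" by (rule surjI[of _ h']) (simp add: h_def h'_def)
    show "range h' = UNIV" by (rule surjI[of _ h]) (simp add: h_def h'_def)
  qed (auto simp: h_def h'_def)
  have "inj h" by (auto simp: h_def inj_def)
  then have "simple_path (h \<circ> c)"
    using assms(1) cont(1)
    by (intro simple_path_continuous_image) (auto intro: continuous_on_subset inj_on_subset)
  moreover have "pathfinish (h \<circ> c) = pathstart (h \<circ> c)"
    using assms(2) by (simp add: pathfinish_compose pathstart_compose)
  ultimately have "inside (path_image (h \<circ> c)) \<noteq> {}"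
    using Jordan_inside_outside by blast
  then show ?thesis
    by (simp add: path_image_compose inside_homeomorphic_image[OF hom])
qed

lemma pathstart_polyline: "pathstart (polyline (a # ps)) = a"
  by (induction "a # ps" arbitrary: a ps rule: polyline.induct) auto

lemma pathfinish_polyline: "ps \<noteq> [] \<Longrightarrow> pathfinish (polyline ps) = last ps"
  by (induction ps rule: polyline.induct) auto

lemma segment_subset_polyline:
  assumes "Suc i < length ps"
  shows "closed_segment (ps ! i) (ps ! Suc i) \<subseteq> path_image (polyline ps)"
  using assms
proof (induction ps arbitrary: i rule: polyline.induct)
  case (4 a b c ps)
  have img: "path_image (polyline (a # b # c # ps)) =
      closed_segment a b \<union> path_image (polyline (b # c # ps))"
    by (simp add: path_image_join pathstart_polyline)
  show ?case
  proof (cases i)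
    case 0
    then show ?thesis unfolding img by auto
  next
    case (Suc j)
    then show ?thesis unfolding img using "4.IH"[of j] "4.prems" by auto
  qed
qed auto

lemma polygon_side_subset_region:
  assumes "T \<in> polygon_sides vs"
  shows "T \<subseteq> region vs"
proof -
  obtain i where i: "i < length vs" and T: "T = closed_segment (vs ! i) (vs ! ((i + 1) mod length vs))"
    using assms by (auto simp: polygon_sides_def)
  let ?ps = "vs @ [hd vs]"
  have "?ps ! Suc i = vs ! ((i + 1) mod length vs)"
  proof (cases "Suc i = length vs")
    case True
    then show ?thesis by (simp add: nth_append hd_conv_nth) (metis hd_conv_nth i length_0_conv not_less0)
  next
    case False
    then show ?thesis using i by (simp add: nth_append)
  qed
  moreover have "?ps ! i = vs ! i" using i by (simp add: nth_append)
  ultimately have "T \<subseteq> path_image (polyline ?ps)"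
    using segment_subset_polyline[of i ?ps] i T by simp
  then show ?thesis by (auto simp: region_def boundary_def)
qed

lemma polyline_translate:
  "ps \<noteq> [] \<Longrightarrow> polyline (map (\<lambda>p. p + z) ps) = (\<lambda>p. p + z) \<circ> polyline ps"
proof (induction ps rule: polyline.induct)
  case (4 a b c ps)
  then show ?case
    by (simp add: path_compose_join) (auto simp: linepath_def fun_eq_iff algebra_simps joinpaths_def)
qed (auto simp: linepath_def fun_eq_iff algebra_simps)

lemma region_translate:
  assumes "vs \<noteq> []"
  shows "region (map (\<lambda>p. p + z) vs) = (\<lambda>p. p + z) ` region vs"
proof -
  have eq: "map (\<lambda>p. p + z) vs @ [hd (map (\<lambda>p. p + z) vs)] = map (\<lambda>p. p + z) (vs @ [hd vs])"
    using assms by (simp add: hd_map)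
  have b: "boundary (map (\<lambda>p. p + z) vs) = (\<lambda>p. p + z) ` boundary vs"
    unfolding boundary_def eq by (subst polyline_translate) (simp_all only: path_image_compose append_is_Nil_conv, simp)
  have "homeomorphism UNIV UNIV (\<lambda>p. p + z) (\<lambda>p. p - z)"
    unfolding homeomorphism_def
    by (auto intro!: continuous_intros surjI[of "\<lambda>p. p + z" "\<lambda>p. p - z"] surjI[of "\<lambda>p. p - z" "\<lambda>p. p + z"])
  from inside_homeomorphic_image[OF this] show ?thesis
    unfolding region_def b by (simp add: image_Un)
qed

lemma is_polygon_region:
  assumes "is_polygon n vs"
  shows compact_region: "compact (region vs)" and interior_region: "interior (region vs) \<noteq> {}"
proof -
  let ?c = "polyline (vs @ [hd vs])"
  have ne: "vs \<noteq> []" and simple: "simple_path ?c" using assms by (auto simp: is_polygon_def)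
  have "pathfinish ?c = hd vs" by (simp add: pathfinish_polyline)
  moreover have "pathstart ?c = hd vs" using ne by (cases vs) (auto simp: pathstart_polyline)
  ultimately have loop: "pathfinish ?c = pathstart ?c" by simp
  have bdd: "bounded (path_image ?c)"
    using simple simple_path_imp_path bounded_path_image by blast
  show "compact (region vs)"
    unfolding region_def boundary_def compact_eq_bounded_closed
    using bdd bounded_inside[OF bdd] closed_path_image_Un_inside[of ?c] simple
    by (auto simp: simple_path_imp_path)
  have "open (inside (path_image ?c))"
    using simple by (intro open_inside closed_path_image simple_path_imp_path)
  then have "inside (path_image ?c) \<subseteq> interior (region vs)"
    unfolding region_def boundary_def by (intro interior_maximal) auto
  then show "interior (region vs) \<noteq> {}"
    using Jordan_inside_nonempty[OF simple loop] by auto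
qed

section \<open>The space of continuous piecewise polynomials\<close>

lemma periodic_minus:
  assumes "periodic f" "z \<in> lattice"
  shows "f (x - z) = f x"
  using assms unfolding periodic_def by (metis diff_add_cancel)

lemma fun_subspace_A_space: "fun_subspace (A_space sp k M)"
proof (rule fun_subspaceI)
  show "(\<lambda>_. 0) \<in> A_space sp k M"
    by (auto simp: A_space_def periodic_def intro!: bexI[OF _ fun_subspace_zero[OF fun_subspace_local_A]])
next
  fix f g assume f: "f \<in> A_space sp k M" and g: "g \<in> A_space sp k M"
  have "\<exists>r\<in>local_A sp k. \<forall>x\<in>region vs. f x + g x = r x" if vs: "vs \<in> cells M" for vs
  proof -
    obtain p q where p: "p \<in> local_A sp k" "\<forall>x\<in>region vs. f x = p x"
      and q: "q \<in> local_A sp k" "\<forall>x\<in>region vs. g x = q x"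
      using f g vs unfolding A_space_def by blast
    show ?thesis
      by (intro bexI[OF _ fun_subspace_add[OF fun_subspace_local_A p(1) q(1)]]) (use p q in auto)
  qed
  with f g show "(\<lambda>x. f x + g x) \<in> A_space sp k M"
    by (simp add: A_space_def periodic_def continuous_on_add)
next
  fix c f assume f: "f \<in> A_space sp k M"
  have "\<exists>r\<in>local_A sp k. \<forall>x\<in>region vs. c *\<^sub>R f x = r x" if vs: "vs \<in> cells M" for vs
  proof -
    obtain p where p: "p \<in> local_A sp k" "\<forall>x\<in>region vs. f x = p x"
      using f vs unfolding A_space_def by blast
    show ?thesis
      by (intro bexI[OF _ fun_subspace_scale[OF fun_subspace_local_A p(1), of c]]) (use p in auto)
  qed
  with f show "(\<lambda>x. c *\<^sub>R f x) \<in> A_space sp k M"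
    by (simp add: A_space_def periodic_def continuous_on_mult_left)
qed

lemma mesh_polygon: "torus_mesh n M \<Longrightarrow> vs \<in> cells M \<Longrightarrow> is_polygon n vs"
  by (simp add: torus_mesh_def)

text \<open>A function in \<open>A\<close> is determined by its values on the cells, as these cover the torus; on each
cell it is a polynomial, determined by its values at the nodes of a grid.\<close>

lemma A_space_nodes:
  assumes M: "torus_mesh n M"
  shows "\<exists>X. finite X \<and> (\<forall>f\<in>A_space sp k M. (\<forall>x\<in>X. f x = 0) \<longrightarrow> f = (\<lambda>_. 0))"
proof -
  have "\<forall>vs\<in>cells M. \<exists>N. finite N \<and> N \<subseteq> region vs \<and>
    (\<forall>p\<in>local_A sp k. (\<forall>x\<in>N. p x = 0) \<longrightarrow> p = (\<lambda>_. 0))"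
    by (intro ballI unisolvent_nodes interior_region[OF mesh_polygon[OF M]])
  from bchoice[OF this] obtain N where N': "\<forall>vs\<in>cells M. finite (N vs) \<and> N vs \<subseteq> region vs \<and>
    (\<forall>p\<in>local_A sp k. (\<forall>x\<in>N vs. p x = 0) \<longrightarrow> p = (\<lambda>_. 0))" ..
  then have N: "\<And>vs. vs \<in> cells M \<Longrightarrow> finite (N vs)" "\<And>vs. vs \<in> cells M \<Longrightarrow> N vs \<subseteq> region vs"
    "\<And>vs p. vs \<in> cells M \<Longrightarrow> p \<in> local_A sp k \<Longrightarrow> \<forall>x\<in>N vs. p x = 0 \<Longrightarrow> p = (\<lambda>_. 0)"
    by simp_all
  define X where "X = (\<Union>vs\<in>cells M. N vs)"
  have "f = (\<lambda>_. 0)" if f: "f \<in> A_space sp k M" and X0: "\<forall>x\<in>X. f x = 0" for f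
  proof
    fix x
    have cell: "f y = 0" if vs: "vs \<in> cells M" and y: "y \<in> region vs" for vs y
    proof -
      obtain p where p: "p \<in> local_A sp k" "\<And>x. x \<in> region vs \<Longrightarrow> f x = p x"
        using f vs unfolding A_space_def by blast
      have "p x = 0" if "x \<in> N vs" for x
      proof -
        have "x \<in> X" "x \<in> region vs" using that vs N(2)[OF vs] by (auto simp: X_def)
        then show ?thesis using p(2) X0 by metis
      qed
      then have "p = (\<lambda>_. 0)" by (intro N(3)[OF vs p(1)]) blast
      then show ?thesis using p(2)[OF y] by simp
    qed
    have "x \<in> (\<Union>K\<in>cells M \<times> lattice. region (lift K))"
      using M by (simp add: torus_mesh_def)
    then obtain vs z where K: "vs \<in> cells M" "z \<in> lattice" "x \<in> region (lift (vs, z))"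
      by (elim UN_E SigmaE) simp
    have "vs \<noteq> []" using mesh_polygon[OF M K(1)] by (auto simp: is_polygon_def)
    then obtain y where "y \<in> region vs" "x = y + z"
      using K(3) by (auto simp: lift_def region_translate)
    moreover have "f (y + z) = f y"
      using f K(2) unfolding A_space_def periodic_def by blast
    ultimately show "f x = 0" using cell[OF K(1)] by simp
  qed
  moreover have "finite X" using N(1) M by (auto simp: X_def torus_mesh_def)
  ultimately show ?thesis by (intro exI[of _ X]) simp
qed

lemma set_integrable_continuous:
  fixes f :: "point \<Rightarrow> real"
  assumes "compact A" "continuous_on A f"
  shows "set_integrable lborel A f"
  using borel_integrable_compact[OF assms] by (simp add: set_integrable_def)

lemma set_integral_combine:
  fixes f g :: "point \<Rightarrow> real"
  assumes "compact A" "continuous_on A f" "continuous_on A g"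
  shows "(LINT x:A|lborel. a * f x + b * g x) = a * (LINT x:A|lborel. f x) + b * (LINT x:A|lborel. g x)"
  using set_integrable_continuous[OF assms(1,2)] set_integrable_continuous[OF assms(1,3)]
  by (simp add: set_integral_add set_integral_mult_right)

text \<open>Definiteness holds because a continuous function whose square has integral zero vanishes on the
unit square, and every point is the translate of a point of this square by a period.\<close>

interpretation A_space: function_inner_product "A_space sp k M" inner_A
  for sp k M
proof
  show "fun_subspace (A_space sp k M)" by (rule fun_subspace_A_space)
  show "inner_A f h = inner_A h f" for f h
    by (simp add: inner_A_def mult.commute)
next
  fix a b f g h assume "f \<in> A_space sp k M" "g \<in> A_space sp k M" "h \<in> A_space sp k M"
  then have "continuous_on (cbox (0, 0) (1, 1)) f" "continuous_on (cbox (0, 0) (1, 1)) g"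
    "continuous_on (cbox (0, 0) (1, 1)) h"
    by (auto simp: A_space_def intro: continuous_on_subset)
  then show "inner_A (\<lambda>x. a * f x + b * g x) h = a * inner_A f h + b * inner_A g h"
    unfolding inner_A_def
    by (subst set_integral_combine[symmetric]) (auto intro!: continuous_intros simp: algebra_simps)
next
  fix f assume f: "f \<in> A_space sp k M" and nz: "f \<noteq> (\<lambda>_. 0)"
  let ?Q = "cbox (0, 0) (1, 1) :: point set"
  have cont: "continuous_on ?Q (\<lambda>x. f x * f x)"
    using f by (auto simp: A_space_def intro!: continuous_intros intro: continuous_on_subset)
  have int: "set_integrable lborel ?Q (\<lambda>x. f x * f x)"
    by (rule set_integrable_continuous[OF compact_cbox cont])
  have eq: "inner_A f f = integral ?Q (\<lambda>x. f x * f x)"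
    unfolding inner_A_def by (rule set_borel_integral_eq_integral[OF int])
  have "inner_A f f \<ge> 0"
    unfolding eq by (intro integral_nonneg integrable_continuous cont) auto
  moreover have "inner_A f f \<noteq> 0"
  proof
    assume "inner_A f f = 0"
    then have has0: "((\<lambda>x. f x * f x) has_integral 0) ?Q"
      using integrable_integral[OF integrable_continuous[OF cont]] eq by simp
    have ne: "box (0, 0) (1, 1) \<noteq> ({} :: point set)"
      by (auto simp: box_ne_empty Basis_prod_def)
    have zero: "f x = 0" if "x \<in> ?Q" for x
      using has_integral_0_cbox_imp_0[OF cont _ has0 ne that] by simp
    have "f x = 0" for x
    proof -
      define z where "z = (of_int \<lfloor>fst x\<rfloor> :: real, of_int \<lfloor>snd x\<rfloor> :: real)"
      have "z \<in> lattice" by (simp add: z_def lattice_def)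
      moreover have "x - z \<in> ?Q"
        using real_of_int_floor_add_one_ge[of "fst x"] real_of_int_floor_add_one_ge[of "snd x"]
        by (cases x) (simp add: z_def cbox_Pair_eq algebra_simps)
      ultimately show ?thesis
        using zero[of "x - z"] periodic_minus[of f z x] f by (simp add: A_space_def)
    qed
    then show False using nz by auto
  qed
  ultimately show "inner_A f f > 0" by simp
qed

lemma A_space_orthonormal_expansion:
  assumes M: "torus_mesh n M"
  shows "\<exists>E. finite E \<and> E \<subseteq> A_space sp k M \<and>
    (\<forall>f\<in>A_space sp k M. f = (\<lambda>x. \<Sum>e\<in>E. inner_A f e * e x))"
proof -
  obtain X where X: "finite X" "\<forall>f\<in>A_space sp k M. (\<forall>x\<in>X. f x = 0) \<longrightarrow> f = (\<lambda>_. 0)"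
    using A_space_nodes[OF M, of sp k] by auto
  show ?thesis
    by (rule A_space.orthonormal_expansion_exists[OF X(1) fun_subspace_A_space subset_refl]) (use X(2) in simp)
qed

section \<open>Cellwise gradients and the product of fields\<close>

lemma cell_poly:
  assumes "f \<in> A_space sp k M" "vs \<in> cells M"
  shows cell_poly_in: "cell_poly sp k f vs \<in> local_A sp k"
    and cell_poly_eq: "\<And>x. x \<in> region vs \<Longrightarrow> cell_poly sp k f vs x = f x"
proof -
  have "\<exists>p. p \<in> local_A sp k \<and> (\<forall>x\<in>region vs. f x = p x)"
    using assms by (auto simp: A_space_def)
  from someI_ex[OF this] show "cell_poly sp k f vs \<in> local_A sp k"
    "\<And>x. x \<in> region vs \<Longrightarrow> cell_poly sp k f vs x = f x"
    by (auto simp: cell_poly_def)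
qed

lemma cell_grad_in_B_space:
  assumes "f \<in> A_space sp k M"
  shows "cell_grad sp k M f \<in> B_space sp k M"
  using cell_poly_in[OF assms] by (auto simp: B_space_def cell_grad_def intro!: grad_in_local_B)

text \<open>The cellwise polynomials depend linearly on \<open>f\<close> only because they are unique: a combination of
two chosen polynomials is a candidate for the combination of the functions.\<close>

lemma cell_grad_combine:
  assumes M: "torus_mesh n M" and f: "f \<in> A_space sp k M" and g: "g \<in> A_space sp k M" and vs: "vs \<in> cells M"
  shows "cell_grad sp k M (\<lambda>x. a * f x + b * g x) vs x =
    a *\<^sub>R cell_grad sp k M f vs x + b *\<^sub>R cell_grad sp k M g vs x"
proof -
  let ?h = "\<lambda>x. a * f x + b * g x" and ?p = "cell_poly sp k f vs" and ?q = "cell_poly sp k g vs"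
  have h: "?h \<in> A_space sp k M"
    using fun_subspace_combine[OF fun_subspace_A_space f g, of a b] by simp
  have pq: "?p \<in> local_A sp k" "?q \<in> local_A sp k"
    using cell_poly_in vs f g by auto
  have "cell_poly sp k ?h vs = (\<lambda>x. a * ?p x + b * ?q x)"
  proof (rule local_A_cong[OF interior_region[OF mesh_polygon[OF M vs]]])
    show "cell_poly sp k ?h vs \<in> local_A sp k" by (rule cell_poly_in[OF h vs])
    show "(\<lambda>x. a * ?p x + b * ?q x) \<in> local_A sp k"
      using fun_subspace_combine[OF fun_subspace_local_A pq, of a b] by simp
    show "cell_poly sp k ?h vs x = a * ?p x + b * ?q x" if "x \<in> region vs" for x
      using that by (simp add: cell_poly_eq[OF h vs] cell_poly_eq[OF f vs] cell_poly_eq[OF g vs])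
  qed
  then show ?thesis using vs by (simp add: cell_grad_def grad_combine[OF pq])
qed

text \<open>Difference quotients of elements of \<open>B_space\<close> need not be in \<open>B_space\<close>, whose elements have a
prescribed value outside the set of cells. Cellwise continuity is stable under such operations and is
enough for the integrals to exist.\<close>

definition cellwise_continuous :: "mesh \<Rightarrow> (polygon \<Rightarrow> point \<Rightarrow> point) \<Rightarrow> bool" where
  "cellwise_continuous M v \<longleftrightarrow> (\<forall>vs\<in>cells M. continuous_on (region vs) (v vs))"

lemma cellwise_continuous_B_space: "v \<in> B_space sp k M \<Longrightarrow> cellwise_continuous M v"
  by (auto simp: cellwise_continuous_def B_space_def intro!: continuous_local_B)

lemma inner_B_sym: "inner_B M v w = inner_B M w v"
  by (simp add: inner_B_def inner_commute)

lemma inner_B_cong: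
  assumes "\<And>vs x. vs \<in> cells M \<Longrightarrow> v vs x = v' vs x"
  shows "inner_B M v w = inner_B M v' w"
  unfolding inner_B_def by (intro sum.cong refl) (simp add: assms)

lemma inner_B_combine:
  assumes M: "torus_mesh n M" and "cellwise_continuous M v" "cellwise_continuous M v'" "cellwise_continuous M w"
  shows "inner_B M (\<lambda>vs x. a *\<^sub>R v vs x + b *\<^sub>R v' vs x) w = a * inner_B M v w + b * inner_B M v' w"
proof -
  have "cell_integral vs (\<lambda>x. (a *\<^sub>R v vs x + b *\<^sub>R v' vs x) \<bullet> w vs x) =
      a * cell_integral vs (\<lambda>x. v vs x \<bullet> w vs x) + b * cell_integral vs (\<lambda>x. v' vs x \<bullet> w vs x)"
    if "vs \<in> cells M" for vs
    using assms(2-4) that compact_region[OF mesh_polygon[OF M that]]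
    unfolding cell_integral_def
    by (subst set_integral_combine[symmetric])
      (auto intro!: continuous_intros simp: inner_add_left cellwise_continuous_def)
  then show ?thesis
    by (simp add: inner_B_def sum.distrib sum_distrib_left)
qed

lemma cellwise_continuous_combine:
  "cellwise_continuous M v \<Longrightarrow> cellwise_continuous M w \<Longrightarrow>
    cellwise_continuous M (\<lambda>vs x. a *\<^sub>R v vs x + b *\<^sub>R w vs x)"
  by (auto simp: cellwise_continuous_def intro!: continuous_intros)

lemma inner_B_nonneg: "inner_B M v v \<ge> 0"
  unfolding inner_B_def cell_integral_def set_lebesgue_integral_def
  by (intro sum_nonneg integral_nonneg_AE) auto

text \<open>The product is only positive semidefinite. The summand 1 makes the factor of \<open>w\<close> positive, so
that no case distinction is needed; the bound is used only to show that \<open>\<langle>v, w\<rangle>\<close> tends to zero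
with \<open>\<parallel>v\<parallel>\<close>.\<close>

lemma inner_B_Cauchy_Schwarz:
  assumes M: "torus_mesh n M" and v: "cellwise_continuous M v" and w: "cellwise_continuous M w"
  shows "\<bar>inner_B M v w\<bar> \<le> sqrt (inner_B M v v) * sqrt (inner_B M w w + 1)"
proof -
  define a b c where "a = inner_B M v v" and "b = inner_B M v w" and "c = inner_B M w w"
  \<comment> \<open>The coefficient \<open>b / c\<close> of the orthogonal projection on \<open>w\<close>, made meaningful for \<open>c = 0\<close>.\<close>
  define \<tau> where "\<tau> = b / (c + 1)"
  have c: "c \<ge> 0" by (simp add: c_def inner_B_nonneg)
  let ?r = "\<lambda>vs x. 1 *\<^sub>R v vs x + (- \<tau>) *\<^sub>R w vs x"
  have r: "cellwise_continuous M ?r" by (rule cellwise_continuous_combine[OF v w])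
  have "inner_B M ?r ?r = 1 * inner_B M v ?r + (- \<tau>) * inner_B M w ?r"
    by (rule inner_B_combine[OF M v w r])
  also have "inner_B M v ?r = a - \<tau> * b"
    using inner_B_combine[OF M v w v, of 1 "-\<tau>"] by (simp add: inner_B_sym a_def b_def)
  also have "inner_B M w ?r = b - \<tau> * c"
    using inner_B_combine[OF M v w w, of 1 "-\<tau>"] by (simp add: inner_B_sym c_def b_def)
  finally have "0 \<le> a - 2 * \<tau> * b + \<tau>\<^sup>2 * c"
    using inner_B_nonneg[of M ?r] by (simp add: algebra_simps power2_eq_square)
  also have "b = \<tau> * (c + 1)" using c by (simp add: \<tau>_def)
  finally have "\<tau>\<^sup>2 * c + 2 * \<tau>\<^sup>2 \<le> a"
    by (simp add: algebra_simps power2_eq_square)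
  then have "\<tau>\<^sup>2 * (c + 1) \<le> a"
    using zero_le_power2[of \<tau>] unfolding distrib_left by linarith
  then have "\<tau>\<^sup>2 * (c + 1) * (c + 1) \<le> a * (c + 1)"
    using c by (intro mult_right_mono) auto
  moreover have "b\<^sup>2 = \<tau>\<^sup>2 * (c + 1) * (c + 1)"
    using c by (simp add: \<tau>_def power2_eq_square)
  ultimately have "b\<^sup>2 \<le> a * (c + 1)" by simp
  then have "sqrt (b\<^sup>2) \<le> sqrt (a * (c + 1))" by (rule real_sqrt_le_mono)
  then show ?thesis by (simp add: a_def b_def c_def real_sqrt_mult)
qed

section \<open>Jumps across the sides\<close>

text \<open>Seen from either neighbour, the component of the trace along the side is the derivative of one
and the same function \<open>s \<mapsto> f (\<gamma> s)\<close>, where \<open>\<gamma>\<close> parametrizes the side: each cellwise polynomial, shifted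
by the period of the lifted cell, agrees with \<open>f\<close> on the side.\<close>

lemma tangential_jump_cell_grad:
  assumes M: "torus_mesh n M" and f: "f \<in> A_space sp k M" and S: "S \<in> sides M" and s: "s \<in> {0..1}"
  shows "jump M (cell_grad sp k M f) S (linepath (fst S) (snd S) s) \<bullet> (snd S - fst S) = 0"
proof -
  let ?\<gamma> = "linepath (fst S) (snd S)"
  have trace: "((\<lambda>s. f (?\<gamma> s)) has_vector_derivative
      side_trace (cell_grad sp k M f) K (?\<gamma> s) \<bullet> (snd S - fst S)) (at s within {0..1})"
    if K: "K \<in> cells M \<times> lattice" "segment S \<in> polygon_sides (lift K)" for K
  proof -
    obtain vs z where Kvz: "K = (vs, z)" and vs: "vs \<in> cells M" and z: "z \<in> lattice" using K(1) by auto
    let ?p = "cell_poly sp k f vs"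
    have p: "?p \<in> local_A sp k" by (rule cell_poly_in[OF f vs])
    have ne: "vs \<noteq> []" using mesh_polygon[OF M vs] by (auto simp: is_polygon_def)
    have on_side: "?p (?\<gamma> r - z) = f (?\<gamma> r)" if "r \<in> {0..1}" for r
    proof -
      have "?\<gamma> r \<in> segment S"
        using that by (auto simp: segment_def linepath_image_01[symmetric])
      then have "?\<gamma> r \<in> region (lift K)" using polygon_side_subset_region[OF K(2)] by auto
      then have "?\<gamma> r - z \<in> region vs"
        using ne by (auto simp: Kvz lift_def region_translate)
      then show ?thesis
        using f by (simp add: cell_poly_eq[OF f vs] periodic_minus[OF _ z] A_space_def)
    qed
    have "((\<lambda>r. ?\<gamma> r - z) has_derivative (\<lambda>h. h *\<^sub>R (snd S - fst S))) (at s within {0..1})"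
      unfolding linepath_def by (auto intro!: derivative_eq_intros simp: algebra_simps)
    from has_derivative_compose[OF this has_derivative_local_A[OF p]]
    have "((\<lambda>r. ?p (?\<gamma> r - z)) has_vector_derivative grad ?p (?\<gamma> s - z) \<bullet> (snd S - fst S)) (at s within {0..1})"
      by (simp add: has_vector_derivative_def)
    then have "((\<lambda>r. f (?\<gamma> r)) has_vector_derivative grad ?p (?\<gamma> s - z) \<bullet> (snd S - fst S)) (at s within {0..1})"
      by (rule has_vector_derivative_transform[OF s, rotated]) (simp add: on_side)
    then show ?thesis by (simp add: side_trace_def Kvz cell_grad_def vs)
  qed
  have "left_cell M S \<in> cells M \<times> lattice" "segment S \<in> polygon_sides (lift (left_cell M S))"
    "right_cell M S \<in> cells M \<times> lattice" "segment S \<in> polygon_sides (lift (right_cell M S))"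
    using M S by (auto simp: torus_mesh_def)
  from vector_derivative_unique_within_closed_interval[of 0 1 s, unfolded box_real, OF _ _ trace[OF this(1,2)] trace[OF this(3,4)]]
  show ?thesis using s by (simp add: jump_def inner_diff_left)
qed

text \<open>In the plane, \<open>J\<close> is orthogonal to the side and \<open>G\<close> is parallel to it.\<close>

lemma inner_eq_zero_of_tangential_normal:
  fixes J G a b :: point
  assumes "J \<bullet> (b - a) = 0" "G \<bullet> side_normal (a, b) = 0" "a \<noteq> b"
  shows "J \<bullet> G = 0"
proof -
  obtain j1 j2 g1 g2 a1 a2 b1 b2 where eqs: "J = (j1, j2)" "G = (g1, g2)" "a = (a1, a2)" "b = (b1, b2)"
    by (metis surj_pair)
  define t1 t2 where "t1 = b1 - a1" and "t2 = b2 - a2"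
  have n0: "t1 \<noteq> 0 \<or> t2 \<noteq> 0" using assms(3) by (auto simp: eqs t1_def t2_def)
  have t: "j1 * t1 + j2 * t2 = 0" using assms(1) by (simp add: eqs t1_def t2_def)
  have "(g1 * t2 - g2 * t1) / dist a b = G \<bullet> side_normal (a, b)"
    by (simp add: eqs side_normal_def t1_def t2_def algebra_simps diff_divide_distrib add_divide_distrib)
  then have n: "g1 * t2 - g2 * t1 = 0" using assms by simp
  \<comment> \<open>Lagrange's identity: both products on the right contain a factor that is zero.\<close>
  have "(j1 * g1 + j2 * g2) * (t1\<^sup>2 + t2\<^sup>2) =
      (j1 * t1 + j2 * t2) * (g1 * t1 + g2 * t2) + (j1 * t2 - j2 * t1) * (g1 * t2 - g2 * t1)"
    by (simp add: algebra_simps power2_eq_square)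
  also have "\<dots> = 0" by (simp add: t n)
  finally show ?thesis using n0 by (auto simp: eqs sum_power2_eq_zero_iff)
qed

lemma side_integral_cell_grad:
  assumes M: "torus_mesh n M" and f: "f \<in> A_space sp k M" and S: "S \<in> sides M"
    and G: "\<And>x. x \<in> segment S \<Longrightarrow> G x \<bullet> side_normal S = 0"
  shows "side_integral S (\<lambda>x. jump M (cell_grad sp k M f) S x \<bullet> G x) = 0"
proof (cases "fst S = snd S")
  case False
  have "jump M (cell_grad sp k M f) S (linepath (fst S) (snd S) s) \<bullet> G (linepath (fst S) (snd S) s) = 0"
    if s: "s \<in> {0..1}" for s
  proof (rule inner_eq_zero_of_tangential_normal[OF tangential_jump_cell_grad[OF M f S s] _ False])
    show "G (linepath (fst S) (snd S) s) \<bullet> side_normal (fst S, snd S) = 0"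
      using G s by (auto simp: segment_def linepath_image_01[symmetric])
  qed
  then have "(LINT s:{0..1::real}|lborel. jump M (cell_grad sp k M f) S (linepath (fst S) (snd S) s) \<bullet>
      G (linepath (fst S) (snd S) s)) = (LINT s:{0..1::real}|lborel. (0::real))"
    by (intro set_lebesgue_integral_cong ballI allI impI) auto
  then show ?thesis by (simp add: side_integral_def set_lebesgue_integral_def)
qed (simp add: side_integral_def)

section \<open>The adjoint gradient and its conservation\<close>

lemma adjoint_grad:
  assumes M: "torus_mesh n M" and u: "u \<in> B_space sp k M"
  shows adjoint_grad_in: "adjoint_grad sp k M u \<in> A_space sp k M"
    and adjoint_grad_inner: "\<And>f. f \<in> A_space sp k M \<Longrightarrow>
      inner_A (adjoint_grad sp k M u) f = inner_B M u (cell_grad sp k M f)"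
proof -
  obtain E where E: "finite E" "E \<subseteq> A_space sp k M"
    and exp': "\<forall>f\<in>A_space sp k M. f = (\<lambda>x. \<Sum>e\<in>E. inner_A f e * e x)"
    using A_space_orthonormal_expansion[OF M, of sp k] by auto
  have exp: "f = (\<lambda>x. \<Sum>e\<in>E. inner_A f e * e x)" if "f \<in> A_space sp k M" for f
    by (rule exp'[rule_format, OF that])
  have lin: "inner_B M u (cell_grad sp k M (\<lambda>x. a * f x + b * g x)) =
      a * inner_B M u (cell_grad sp k M f) + b * inner_B M u (cell_grad sp k M g)"
    if f: "f \<in> A_space sp k M" and g: "g \<in> A_space sp k M" for a b f g
  proof -
    have "inner_B M u (cell_grad sp k M (\<lambda>x. a * f x + b * g x)) =
        inner_B M (\<lambda>vs x. a *\<^sub>R cell_grad sp k M f vs x + b *\<^sub>R cell_grad sp k M g vs x) u"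
      by (subst inner_B_sym) (rule inner_B_cong[OF cell_grad_combine[OF M f g]])
    also have "\<dots> = a * inner_B M (cell_grad sp k M f) u + b * inner_B M (cell_grad sp k M g) u"
      using M u f g by (intro inner_B_combine) (auto intro!: cellwise_continuous_B_space cell_grad_in_B_space)
    finally show ?thesis by (simp add: inner_B_sym)
  qed
  have "\<exists>!w. w \<in> A_space sp k M \<and> (\<forall>f\<in>A_space sp k M. inner_A w f = inner_B M u (cell_grad sp k M f))"
    by (rule A_space.riesz_representation[OF E exp lin])
  from theI'[OF this] show "adjoint_grad sp k M u \<in> A_space sp k M"
    "\<And>f. f \<in> A_space sp k M \<Longrightarrow> inner_A (adjoint_grad sp k M u) f = inner_B M u (cell_grad sp k M f)"
    by (auto simp: adjoint_grad_def)
qed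

text \<open>This says that \<open>\<nabla>\<^sup>\<star>\<close> commutes with the time derivative, in the case \<open>\<nabla>\<^sup>\<star>d = 0\<close>. Convergence of
\<open>u\<close> is known only in the \<open>L\<^sup>2\<close> norm, so it is transferred through the finitely many products with
the \<open>\<nabla>e\<close>, which are continuous for this norm.\<close>

lemma adjoint_grad_has_time_derivative_zero:
  assumes M: "torus_mesh n M"
    and u: "\<And>s. s \<in> I \<Longrightarrow> u s \<in> B_space sp k M" and d: "d \<in> B_space sp k M" and t: "t \<in> I"
    and deriv: "has_time_derivative_B M u d t I"
    and orth: "\<And>f. f \<in> A_space sp k M \<Longrightarrow> inner_B M d (cell_grad sp k M f) = 0"
  shows "has_time_derivative_A (\<lambda>s. adjoint_grad sp k M (u s)) (\<lambda>x. 0) t I"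
proof -
  let ?A = "A_space sp k M" and ?w = "\<lambda>s. adjoint_grad sp k M (u s)"
  obtain E where E: "finite E" "E \<subseteq> ?A"
    and exp': "\<forall>f\<in>?A. f = (\<lambda>x. \<Sum>e\<in>E. inner_A f e * e x)"
    using A_space_orthonormal_expansion[OF M, of sp k] by auto
  have exp: "f = (\<lambda>x. \<Sum>e\<in>E. inner_A f e * e x)" if "f \<in> ?A" for f
    by (rule exp'[rule_format, OF that])
  define r where "r s = (\<lambda>vs x. (1 / (s - t)) *\<^sub>R (u s vs x - u t vs x) - d vs x)" for s
  define D where "D s = (\<lambda>x. (?w s x - ?w t x) / (s - t))" for s
  define \<psi> where "\<psi> e s = inner_B M (r s) (cell_grad sp k M e)" for e s
  note cc = cellwise_continuous_B_space
  \<comment> \<open>The remainder and the difference quotient as linear combinations, the form to which the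
    bilinearity of the products applies.\<close>
  have r_eq: "r s = (\<lambda>vs x. 1 *\<^sub>R ((1 / (s - t)) *\<^sub>R u s vs x + (- 1 / (s - t)) *\<^sub>R u t vs x) + (-1) *\<^sub>R d vs x)" for s
    by (auto simp: r_def fun_eq_iff scaleR_diff_right)
  have D_eq: "D s = (\<lambda>x. (1 / (s - t)) * ?w s x + (- 1 / (s - t)) * ?w t x)" for s
    by (auto simp: D_def fun_eq_iff diff_divide_distrib)
  have r: "cellwise_continuous M (r s)" if "s \<in> I" for s
    unfolding r_eq by (intro cellwise_continuous_combine cc[OF u] cc[OF d] that t)
  have DA: "D s \<in> ?A" if "s \<in> I" for s
    using fun_subspace_combine[OF fun_subspace_A_space adjoint_grad_in[OF M u[OF that]] adjoint_grad_in[OF M u[OF t]],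
        of "1 / (s - t)" "- 1 / (s - t)"]
    unfolding D_eq by simp
  have D\<psi>: "inner_A (D s) e = \<psi> e s" if s: "s \<in> I" and e: "e \<in> ?A" for s e
  proof -
    note ce = cc[OF cell_grad_in_B_space[OF e]]
    have "inner_A (D s) e = (1 / (s - t)) * inner_B M (u s) (cell_grad sp k M e)
        + (- 1 / (s - t)) * inner_B M (u t) (cell_grad sp k M e)"
      unfolding D_eq A_space.lin[OF adjoint_grad_in[OF M u[OF s]] adjoint_grad_in[OF M u[OF t]] e]
      by (simp only: adjoint_grad_inner[OF M u[OF s] e] adjoint_grad_inner[OF M u[OF t] e])
    also have "\<dots> = \<psi> e s"
      unfolding \<psi>_def r_eq
      by (subst inner_B_combine[OF M cellwise_continuous_combine[OF cc[OF u[OF s]] cc[OF u[OF t]]] cc[OF d] ce],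
          subst inner_B_combine[OF M cc[OF u[OF s]] cc[OF u[OF t]] ce]) (simp add: orth[OF e])
    finally show ?thesis .
  qed
  have ev: "\<forall>\<^sub>F s in at t within I. s \<in> I"
    by (simp add: eventually_at_filter)
  have lim: "((\<lambda>s. sqrt (inner_B M (r s) (r s))) \<longlongrightarrow> 0) (at t within I)"
    using deriv by (simp add: has_time_derivative_B_def r_def Let_def)
  have \<psi>0: "(\<psi> e \<longlongrightarrow> 0) (at t within I)" if e: "e \<in> ?A" for e
  proof (rule Lim_null_comparison)
    let ?C = "sqrt (inner_B M (cell_grad sp k M e) (cell_grad sp k M e) + 1)"
    show "\<forall>\<^sub>F s in at t within I. norm (\<psi> e s) \<le> sqrt (inner_B M (r s) (r s)) * ?C"
      using ev by eventually_elim
        (simp add: \<psi>_def inner_B_Cauchy_Schwarz[OF M r cc[OF cell_grad_in_B_space[OF e]]])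
    show "((\<lambda>s. sqrt (inner_B M (r s) (r s)) * ?C) \<longlongrightarrow> 0) (at t within I)"
      using tendsto_mult_right[OF lim, of ?C] by simp
  qed
  have "((\<lambda>s. sqrt (\<Sum>e\<in>E. \<psi> e s * \<psi> e s)) \<longlongrightarrow> sqrt (\<Sum>e\<in>E. 0 * 0)) (at t within I)"
    using E by (intro tendsto_intros \<psi>0) auto
  moreover have "\<forall>\<^sub>F s in at t within I. sqrt (\<Sum>e\<in>E. \<psi> e s * \<psi> e s) = sqrt (inner_A (D s) (D s))"
    using ev
  proof eventually_elim
    case (elim s)
    have "inner_A (D s) (D s) = inner_A (\<lambda>x. \<Sum>e\<in>E. inner_A (D s) e * e x) (D s)"
      using exp[OF DA[OF elim]] by simp
    also have "\<dots> = (\<Sum>e\<in>E. inner_A (D s) e * inner_A e (D s))"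
      by (rule A_space.ip_sum[OF E DA[OF elim]])
    also have "\<dots> = (\<Sum>e\<in>E. \<psi> e s * \<psi> e s)"
      using D\<psi>[OF elim] E(2) by (intro sum.cong) (auto simp: A_space.sym)
    finally show ?case by simp
  qed
  ultimately have "((\<lambda>s. sqrt (inner_A (D s) (D s))) \<longlongrightarrow> sqrt (\<Sum>e\<in>E. 0 * 0)) (at t within I)"
    by (rule Lim_transform_eventually)
  then show ?thesis by (simp add: has_time_derivative_A_def D_def Let_def)
qed

theorem proposition3:
  fixes sp :: curl_space and k :: nat and M :: mesh and I :: "real set"
    and u u' :: "real \<Rightarrow> polygon \<Rightarrow> point \<Rightarrow> point"
    and g :: "real \<Rightarrow> polygon \<Rightarrow> point \<Rightarrow> real"
    and G :: "real \<Rightarrow> side \<Rightarrow> point \<Rightarrow> point"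
  assumes mesh: "torus_mesh (corners sp) M"
    and interval: "is_interval I"
    and u_in: "\<And>t. t \<in> I \<Longrightarrow> u t \<in> B_space sp k M"
    and u'_in: "\<And>t. t \<in> I \<Longrightarrow> u' t \<in> B_space sp k M"
    and deriv: "\<And>t. t \<in> I \<Longrightarrow> has_time_derivative_B M u (u' t) t I"
    and g_integrable: "\<And>t vs. t \<in> I \<Longrightarrow> vs \<in> cells M \<Longrightarrow>
          set_integrable lborel (region vs) (g t vs)"
    and G_integrable: "\<And>t S. t \<in> I \<Longrightarrow> S \<in> sides M \<Longrightarrow> side_integrable S (G t S)"
    and scheme: "\<And>t v. t \<in> I \<Longrightarrow> v \<in> B_space sp k M \<Longrightarrow>
          (\<Sum>vs\<in>cells M. cell_integral vs (\<lambda>x. v vs x \<bullet> u' t vs x))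
          - (\<Sum>vs\<in>cells M. cell_integral vs (\<lambda>x. g t vs x * perp_div (v vs) x))
          + (\<Sum>S\<in>sides M. side_integral S (\<lambda>x. jump M v S x \<bullet> G t S x)) = 0"
    and orthogonal: "\<And>t S x. t \<in> I \<Longrightarrow> S \<in> sides M \<Longrightarrow> x \<in> segment S \<Longrightarrow>
          G t S x \<bullet> side_normal S = 0"
  shows "\<forall>t\<in>I. has_time_derivative_A (\<lambda>s. adjoint_grad sp k M (u s)) (\<lambda>x. 0) t I"
proof
  fix t assume t: "t \<in> I"
  have "inner_B M (u' t) (cell_grad sp k M f) = 0" if f: "f \<in> A_space sp k M" for f
  proof -
    let ?v = "cell_grad sp k M f"
    have "perp_div (?v vs) x = 0" if "vs \<in> cells M" for vs x
      using that perp_div_grad[OF cell_poly_in[OF f that]] by (simp add: cell_grad_def)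
    then have "(\<Sum>vs\<in>cells M. cell_integral vs (\<lambda>x. g t vs x * perp_div (?v vs) x)) = 0"
      by (intro sum.neutral) (simp add: cell_integral_def set_lebesgue_integral_def)
    moreover have "(\<Sum>S\<in>sides M. side_integral S (\<lambda>x. jump M ?v S x \<bullet> G t S x)) = 0"
      by (intro sum.neutral ballI side_integral_cell_grad[OF mesh f] orthogonal[OF t])
    ultimately have "inner_B M ?v (u' t) = 0"
      using scheme[OF t cell_grad_in_B_space[OF f]] by (simp add: inner_B_def)
    then show ?thesis by (simp add: inner_B_sym)
  qed
  then show "has_time_derivative_A (\<lambda>s. adjoint_grad sp k M (u s)) (\<lambda>x. 0) t I"
    by (intro adjoint_grad_has_time_derivative_zero[OF mesh u_in u'_in[OF t] t deriv[OF t]])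
qed

end
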